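(* Let $\beta>0$ and $\Lambda>0$, let $L\ge1$ be an integer and set $\tau:=\beta\Lambda/(2L)$. In the setting of the Pauli-path expansion described in the context (with this $\tau$ and an arbitrary sequence $P_1,\dots,P_L$, e.g. sampled by qDRIFT from a Hamiltonian $H=\sum_j h_jP^{(j)}$ with $\Lambda=\sum_j|h_j|$), let $k$ be an integer with $k>e\beta\Lambda/2$, let $\widetilde A_L:=\sum_{\gamma:\ r(\gamma)\le k}\mathrm{coef}(\gamma)Q_L(\gamma)$, and define $\rho:=A_L/\operatorname{Tr}(A_L)$, $\widetilde\rho:=\widetilde A_L/\operatorname{Tr}(\widetilde A_L)$. Set $$\varepsilon:=e^{\beta\Lambda/2}\Big(\frac{e\beta\Lambda}{2k}\Big)^{k}.$$ If $\varepsilon<1$, then $\|\rho-\widetilde\rho\|_1\le\frac{2\varepsilon}{1-\varepsilon}$; in particular $\|\rho-\widetilde\rho\|_1\in\mathcal O\big(e^{\beta\Lambda/2}(e\beta\Lambda/(2k))^k\big)$, and for every observable $O$, $|\operatorname{Tr}[O(\rho-\widetilde\rho)]|\le\|O\|_\infty\frac{2\varepsilon}{1-\varepsilon}$.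
   Context: Pauli-path expansion. Let $n\ge1$ and $\mathcal P_n=\{I,X,Y,Z\}^{\otimes n}$. Fix $\tau>0$, an integer $L\ge1$, and a sequence $P_1,\dots,P_L$ of Hermitian operators, each of the form $\pm P$ with $P\in\mathcal P_n\setminus\{I^{\otimes n}\}$. Define $\mathcal E_t(X)=e^{-\tau P_t/2}\,X\,e^{-\tau P_t/2}$ and $A_L:=\mathcal E_L\circ\cdots\circ\mathcal E_1(\mathbb I)$. For $Q\in\mathcal P_n$: if $P_t$ anticommutes with $Q$ then $\mathcal E_t(Q)=Q$; if $P_t$ commutes with $Q$ then $\mathcal E_t(Q)=\cosh(\tau)Q-\sinh(\tau)P_tQ$, where $P_tQ=s\,Q'$ for a unique sign $s\in\{\pm1\}$ and $Q'\in\mathcal P_n$. A Pauli path is a sequence $\gamma=(Q_0,Q_1,\dots,Q_L)$ of elements of $\mathcal P_n$ with $Q_0=\mathbb I$ such that for each $t\in\{1,\dots,L\}$ exactly one of the following holds: (a) $P_t$ anticommutes with $Q_{t-1}$ and $Q_t=Q_{t-1}$ (step factor $1$); (b) $P_t$ commutes with $Q_{t-1}$ and $Q_t=Q_{t-1}$ (step factor $\cosh\tau$); (c) $P_t$ commutes with $Q_{t-1}$ and $Q_t=Q'$ where $P_tQ_{t-1}=sQ'$ (step factor $-s\sinh\tau$; this is called a non-identity update). $\mathrm{coef}(\gamma)$ is the product of the $L$ step factors, $r(\gamma)$ is the number of non-identity updates, and $Q_t(\gamma)$ denotes the $t$-th entry. Then $A_L=\sum_\gamma\mathrm{coef}(\gamma)\,Q_L(\gamma)$,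 the sum ranging over all Pauli paths. *)

theory Defs
  imports Complex_Main "Jordan_Normal_Form.Schur_Decomposition" "Jordan_Normal_Form.Char_Poly"
begin

text \<open>Single-qubit Pauli matrices indexed by 0 = I, 1 = X, 2 = Y, 3 = Z; entries at bits a, b.\<close>
definition sigma :: "nat \<Rightarrow> nat \<Rightarrow> nat \<Rightarrow> complex" where
  "sigma c a b =
     (if c = 0 then (if a = b then 1 else 0)
      else if c = 1 then (if a \<noteq> b then 1 else 0)
      else if c = 2 then (if a = 0 \<and> b = 1 then - \<i> else if a = 1 \<and> b = 0 then \<i> else 0)
      else (if a = b then (if a = 0 then 1 else -1) else 0))"

definition paulis :: "nat \<Rightarrow> (nat \<Rightarrow> nat) set" where
  "paulis n = {p. (\<forall>q<n. p q < 4) \<and> (\<forall>q\<ge>n. p q = 0)}"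

definition pauli_id :: "nat \<Rightarrow> nat" where
  "pauli_id = (\<lambda>_. 0)"

text \<open>Matrix of a Pauli string (tensor product of the single-qubit factors), dimension 2^n.\<close>
definition pmat :: "nat \<Rightarrow> (nat \<Rightarrow> nat) \<Rightarrow> complex mat" where
  "pmat n p = mat (2^n) (2^n)
     (\<lambda>(i,j). \<Prod>q<n. sigma (p q) (i div 2^q mod 2) (j div 2^q mod 2))"

definition mtrace :: "complex mat \<Rightarrow> complex" where
  "mtrace M = (\<Sum>i<dim_row M. M $$ (i,i))"

definition mexp :: "complex mat \<Rightarrow> complex mat" where
  "mexp M = mat (dim_row M) (dim_col M)
     (\<lambda>(i,j). \<Sum>k. (M ^\<^sub>m k) $$ (i,j) / of_nat (fact k))"

text \<open>Trace norm: sum of the singular values (square roots of the eigenvalues of M^* M,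
  counted with algebraic multiplicity).\<close>
definition trace_norm :: "complex mat \<Rightarrow> real" where
  "trace_norm M = sum_mset (image_mset (\<lambda>x. sqrt (Re x)) (proots (char_poly (mat_adjoint M * M))))"

definition vnorm :: "complex vec \<Rightarrow> real" where
  "vnorm v = sqrt (\<Sum>i<dim_vec v. (cmod (v $ i))^2)"

definition op_norm :: "complex mat \<Rightarrow> real" where
  "op_norm M = Sup {vnorm (M *\<^sub>v v) | v. v \<in> carrier_vec (dim_col M) \<and> vnorm v = 1}"

definition gen_mat :: "nat \<Rightarrow> (nat \<Rightarrow> real) \<Rightarrow> (nat \<Rightarrow> nat \<Rightarrow> nat) \<Rightarrow> nat \<Rightarrow> complex mat" where
  "gen_mat n sg G t = complex_of_real (sg t) \<cdot>\<^sub>m pmat n (G t)"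

definition chan :: "nat \<Rightarrow> real \<Rightarrow> (nat \<Rightarrow> real) \<Rightarrow> (nat \<Rightarrow> nat \<Rightarrow> nat) \<Rightarrow> nat \<Rightarrow> complex mat \<Rightarrow> complex mat" where
  "chan n \<tau> sg G t X =
     mexp (complex_of_real (- \<tau> / 2) \<cdot>\<^sub>m gen_mat n sg G t) * X
       * mexp (complex_of_real (- \<tau> / 2) \<cdot>\<^sub>m gen_mat n sg G t)"

fun Aop :: "nat \<Rightarrow> real \<Rightarrow> (nat \<Rightarrow> real) \<Rightarrow> (nat \<Rightarrow> nat \<Rightarrow> nat) \<Rightarrow> nat \<Rightarrow> complex mat" where
  "Aop n \<tau> sg G 0 = 1\<^sub>m (2^n)"
| "Aop n \<tau> sg G (Suc t) = chan n \<tau> sg G (Suc t) (Aop n \<tau> sg G t)"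

definition commutes :: "complex mat \<Rightarrow> complex mat \<Rightarrow> bool" where
  "commutes A B \<longleftrightarrow> A * B = B * A"

definition anticommutes :: "complex mat \<Rightarrow> complex mat \<Rightarrow> bool" where
  "anticommutes A B \<longleftrightarrow> A * B = - (B * A)"

definition step_a :: "nat \<Rightarrow> complex mat \<Rightarrow> (nat \<Rightarrow> nat) \<Rightarrow> (nat \<Rightarrow> nat) \<Rightarrow> bool" where
  "step_a n P Qp Qn \<longleftrightarrow> anticommutes P (pmat n Qp) \<and> Qn = Qp"

definition step_b :: "nat \<Rightarrow> complex mat \<Rightarrow> (nat \<Rightarrow> nat) \<Rightarrow> (nat \<Rightarrow> nat) \<Rightarrow> bool" where
  "step_b n P Qp Qn \<longleftrightarrow> commutes P (pmat n Qp) \<and> Qn = Qp"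

definition step_c :: "nat \<Rightarrow> complex mat \<Rightarrow> (nat \<Rightarrow> nat) \<Rightarrow> (nat \<Rightarrow> nat) \<Rightarrow> bool" where
  "step_c n P Qp Qn \<longleftrightarrow> commutes P (pmat n Qp) \<and>
     (\<exists>s::real. (s = 1 \<or> s = -1) \<and> P * pmat n Qp = complex_of_real s \<cdot>\<^sub>m pmat n Qn)"

definition step_sign :: "nat \<Rightarrow> complex mat \<Rightarrow> (nat \<Rightarrow> nat) \<Rightarrow> (nat \<Rightarrow> nat) \<Rightarrow> real" where
  "step_sign n P Qp Qn =
     (THE s::real. (s = 1 \<or> s = -1) \<and> P * pmat n Qp = complex_of_real s \<cdot>\<^sub>m pmat n Qn)"

definition step_factor :: "nat \<Rightarrow> real \<Rightarrow> complex mat \<Rightarrow> (nat \<Rightarrow> nat) \<Rightarrow> (nat \<Rightarrow> nat) \<Rightarrow> real" where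
  "step_factor n \<tau> P Qp Qn =
     (if step_a n P Qp Qn then 1
      else if step_b n P Qp Qn then cosh \<tau>
      else - step_sign n P Qp Qn * sinh \<tau>)"

definition pauli_path :: "nat \<Rightarrow> (nat \<Rightarrow> real) \<Rightarrow> (nat \<Rightarrow> nat \<Rightarrow> nat) \<Rightarrow> nat \<Rightarrow> (nat \<Rightarrow> nat) list \<Rightarrow> bool" where
  "pauli_path n sg G L \<gamma> \<longleftrightarrow>
     length \<gamma> = L + 1 \<and> set \<gamma> \<subseteq> paulis n \<and> \<gamma> ! 0 = pauli_id \<and>
     (\<forall>t\<in>{1..L}.
        let P = gen_mat n sg G t; Qp = \<gamma> ! (t - 1); Qn = \<gamma> ! t;
            a = step_a n P Qp Qn; b = step_b n P Qp Qn; c = step_c n P Qp Qn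
        in (a \<and> \<not> b \<and> \<not> c) \<or> (\<not> a \<and> b \<and> \<not> c) \<or> (\<not> a \<and> \<not> b \<and> c))"

definition path_coef :: "nat \<Rightarrow> real \<Rightarrow> (nat \<Rightarrow> real) \<Rightarrow> (nat \<Rightarrow> nat \<Rightarrow> nat) \<Rightarrow> nat \<Rightarrow> (nat \<Rightarrow> nat) list \<Rightarrow> real" where
  "path_coef n \<tau> sg G L \<gamma> =
     (\<Prod>t\<in>{1..L}. step_factor n \<tau> (gen_mat n sg G t) (\<gamma> ! (t - 1)) (\<gamma> ! t))"

definition path_r :: "nat \<Rightarrow> (nat \<Rightarrow> real) \<Rightarrow> (nat \<Rightarrow> nat \<Rightarrow> nat) \<Rightarrow> nat \<Rightarrow> (nat \<Rightarrow> nat) list \<Rightarrow> nat" where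
  "path_r n sg G L \<gamma> =
     card {t\<in>{1..L}. step_c n (gen_mat n sg G t) (\<gamma> ! (t - 1)) (\<gamma> ! t)}"

definition Atrunc :: "nat \<Rightarrow> real \<Rightarrow> (nat \<Rightarrow> real) \<Rightarrow> (nat \<Rightarrow> nat \<Rightarrow> nat) \<Rightarrow> nat \<Rightarrow> nat \<Rightarrow> complex mat" where
  "Atrunc n \<tau> sg G L k = mat (2^n) (2^n) (\<lambda>(i,j).
     \<Sum>\<gamma>\<in>{\<gamma>. pauli_path n sg G L \<gamma> \<and> path_r n sg G L \<gamma> \<le> k}.
        complex_of_real (path_coef n \<tau> sg G L \<gamma>) * pmat n (\<gamma> ! L) $$ (i,j))"

end

theory Submission
  imports Defs "HOL-Analysis.L2_Norm"
begin

text \<open>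
  Write \<open>x = \<beta>\<Lambda>/2 = L\<tau>\<close>, \<open>N = 2^n\<close>, and let \<open>D\<close> be the sum over the discarded paths. Weighting a path with
  \<open>w\<close> per non-identity update, \<open>\<Sum> |coef| w^r \<le> (cosh \<tau> + w sinh \<tau>)^L \<le> exp (w x)\<close> for \<open>w \<ge> 1\<close>, so
  \<open>w = k/x\<close> bounds the discarded coefficients by \<open>(ex/k)^k \<le> \<epsilon>\<close>.

  The operator \<open>A = V V\<^sup>*\<close> is positive with determinant 1: a Pauli string \<open>R\<close> anticommuting with the
  generator satisfies \<open>B R B = R\<close> for the factor \<open>B\<close> of \<open>V\<close>, hence \<open>(det B)^2 = 1\<close>. By the inequality of
  arithmetic and geometric means, \<open>Tr A \<ge> N\<close>.

  If \<open>|M v| \<le> c |v|\<close> for all \<open>v\<close>, then \<open>|Tr (M A)| \<le> c Tr A\<close> and \<open>|Tr (M D)| \<le> c N \<epsilon> \<le> c \<epsilon> Tr A\<close>, which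
  gives \<open>|Tr (M (\<rho> - \<rho>'))| \<le> 2 c \<epsilon> / (1 - \<epsilon>)\<close>. Both claims follow, because the trace norm of a matrix is
  \<open>Tr (U _)\<close> for some contraction \<open>U\<close>.
\<close>

section \<open>Adjoints, norms and traces\<close>

lemma dim_mat_adjoint [simp]:
  "dim_row (mat_adjoint A) = dim_col A" "dim_col (mat_adjoint A) = dim_row A"
  by (simp_all add: mat_adjoint_def)

lemma mat_adjoint_carrier [simp]: "A \<in> carrier_mat n m \<Longrightarrow> mat_adjoint A \<in> carrier_mat m n"
  by (auto intro: carrier_matI)

lemma index_mat_adjoint [simp]:
  "i < dim_col A \<Longrightarrow> j < dim_row A \<Longrightarrow> mat_adjoint A $$ (i, j) = conjugate (A $$ (j, i))"
  by (simp add: mat_adjoint_def mat_of_rows_index)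

lemma row_mat_adjoint [simp]: "i < dim_col A \<Longrightarrow> row (mat_adjoint A) i = conjugate (col A i)"
  by (rule eq_vecI) auto

lemma col_mat_adjoint [simp]: "j < dim_row A \<Longrightarrow> col (mat_adjoint A) j = conjugate (row A j)"
  by (rule eq_vecI) auto

lemma mat_adjoint_mat_adjoint [simp]: "mat_adjoint (mat_adjoint A) = A"
  by (rule eq_matI) auto

lemma mat_adjoint_mult:
  assumes A: "A \<in> carrier_mat n m" and B: "B \<in> carrier_mat m p"
  shows "mat_adjoint (A * B) = mat_adjoint B * mat_adjoint A"
proof (rule eq_matI)
  fix i j assume "i < dim_row (mat_adjoint B * mat_adjoint A)" "j < dim_col (mat_adjoint B * mat_adjoint A)"
  hence ij: "i < p" "j < n" using A B by auto
  have row: "row A j \<in> carrier_vec m" and col: "col B i \<in> carrier_vec m" using A B by auto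
  show "mat_adjoint (A * B) $$ (i, j) = (mat_adjoint B * mat_adjoint A) $$ (i, j)"
    using A B ij conjugate_sprod_vec[OF row col]
      comm_scalar_prod[OF carrier_vec_conjugate[OF row] carrier_vec_conjugate[OF col]] by simp
qed (use A B in auto)

lemma adjoint_mult_self_mult:
  assumes M: "M \<in> carrier_mat m n" and W: "W \<in> carrier_mat n p"
  shows "mat_adjoint (M * W) * (M * W) = mat_adjoint W * (mat_adjoint M * M) * W"
proof -
  have M': "mat_adjoint M \<in> carrier_mat n m" and W': "mat_adjoint W \<in> carrier_mat p n"
    and MW: "M * W \<in> carrier_mat m p" using M W by auto
  show ?thesis
    unfolding mat_adjoint_mult[OF M W] assoc_mult_mat[OF W' M' MW]
      assoc_mult_mat[OF W' mult_carrier_mat[OF M' M] W] assoc_mult_mat[OF M' M W] ..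
qed

lemma mat_adjoint_add:
  "A \<in> carrier_mat n m \<Longrightarrow> B \<in> carrier_mat n m \<Longrightarrow> mat_adjoint (A + B) = mat_adjoint A + mat_adjoint B"
  by (rule eq_matI) (auto simp: conjugate_dist_add)

lemma mat_adjoint_smult: "mat_adjoint (c \<cdot>\<^sub>m A) = conjugate c \<cdot>\<^sub>m mat_adjoint A"
  by (rule eq_matI) (auto simp: conjugate_dist_mul)

lemma mat_adjoint_one [simp]: "mat_adjoint (1\<^sub>m n :: complex mat) = 1\<^sub>m n"
  by (rule eq_matI) auto

lemma mat_adjoint_mat_diag: "mat_adjoint (mat_diag n d) = mat_diag n (\<lambda>i. conjugate (d i))"
  by (rule eq_matI) (auto simp: mat_diag_def)

lemma index_adjoint_mult:
  assumes "X \<in> carrier_mat n m" "Y \<in> carrier_mat n p" "i < m" "j < p"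
  shows "(mat_adjoint X * Y) $$ (i, j) = col Y j \<bullet>c col X i"
  using assms by (simp add: conjugate_vec_sprod_comm[of _ n])

lemma index_adjoint_mult_vec:
  assumes "X \<in> carrier_mat n m" "v \<in> carrier_vec n" "i < m"
  shows "(mat_adjoint X *\<^sub>v v) $ i = v \<bullet>c col X i"
  using assms by (simp add: conjugate_vec_sprod_comm[of _ n])

lemma cscalar_prod_mult_mat_vec:
  assumes A: "A \<in> carrier_mat n m" and v: "v \<in> carrier_vec m" and w: "w \<in> carrier_vec n"
  shows "(A *\<^sub>v v) \<bullet>c w = v \<bullet>c (mat_adjoint A *\<^sub>v w)"
proof -
  have "conjugate (mat_adjoint A *\<^sub>v w) = transpose_mat A *\<^sub>v conjugate w"
    using A w by (intro eq_vecI) (auto simp: conjugate_sprod_vec[of _ n])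
  thus ?thesis
    using transpose_vec_mult_scalar[OF A v carrier_vec_conjugate[OF w]] A v w
      comm_scalar_prod[of "A *\<^sub>v v" n "conjugate w"]
      comm_scalar_prod[of v m "transpose_mat A *\<^sub>v conjugate w"]
    by simp
qed

lemma mult_mat_zero_vec: "A *\<^sub>v 0\<^sub>v (dim_col A) = 0\<^sub>v (dim_row (A :: 'a :: semiring_0 mat))"
  by (rule eq_vecI) (auto intro!: scalar_prod_right_zero)

lemma vnorm_L2: "vnorm v = L2_set (\<lambda>i. cmod (v $ i)) {..<dim_vec v}"
  by (simp add: vnorm_def L2_set_def)

lemma vnorm_nonneg [simp]: "vnorm v \<ge> 0"
  by (simp add: vnorm_def sum_nonneg)

lemma vnorm_eq_0_iff: "vnorm v = 0 \<longleftrightarrow> v = 0\<^sub>v (dim_vec v)"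
  by (auto simp: vnorm_L2 L2_set_eq_0_iff intro!: eq_vecI) (metis index_zero_vec(1))

lemma vnorm_smult: "vnorm (c \<cdot>\<^sub>v v) = cmod c * vnorm v"
  by (simp add: vnorm_def norm_mult power_mult_distrib sum_distrib_left[symmetric] real_sqrt_mult)

lemma norm_index_le_vnorm: "i < dim_vec v \<Longrightarrow> cmod (v $ i) \<le> vnorm v"
  unfolding vnorm_L2 by (rule member_le_L2_set) auto

lemma vnorm_unit_vec: "i < n \<Longrightarrow> vnorm (unit_vec n i) = 1"
  by (simp add: vnorm_def unit_vec_def if_distrib[of "\<lambda>x. (cmod x)\<^sup>2"] cong: if_cong)

lemma cscalar_prod_sum:
  "dim_vec v = n \<Longrightarrow> dim_vec w = n \<Longrightarrow> (v :: complex vec) \<bullet>c w = (\<Sum>i<n. v $ i * cnj (w $ i))"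
  by (auto simp: scalar_prod_def lessThan_atLeast0)

lemma cscalar_prod_self: "v \<bullet>c v = complex_of_real ((vnorm v)\<^sup>2)"
  by (simp add: cscalar_prod_sum vnorm_def sum_nonneg complex_norm_square[symmetric])

lemma norm_cscalar_prod_le:
  assumes "dim_vec v = dim_vec w"
  shows "cmod (v \<bullet>c w) \<le> vnorm v * vnorm w"
proof -
  have "cmod (v \<bullet>c w) \<le> (\<Sum>i<dim_vec w. \<bar>cmod (v $ i)\<bar> * \<bar>cmod (w $ i)\<bar>)"
    unfolding cscalar_prod_sum[OF assms refl] by (rule order_trans[OF norm_sum]) (simp add: norm_mult)
  also have "\<dots> \<le> vnorm v * vnorm w"
    unfolding vnorm_L2 assms by (rule L2_set_mult_ineq)
  finally show ?thesis .
qed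

lemma vnorm_mult_mat_vec_square:
  assumes A: "A \<in> carrier_mat n m" and v: "v \<in> carrier_vec m"
  shows "complex_of_real ((vnorm (A *\<^sub>v v))\<^sup>2) = v \<bullet>c ((mat_adjoint A * A) *\<^sub>v v)"
  using A v cscalar_prod_mult_mat_vec[OF A v, of "A *\<^sub>v v"]
  by (simp add: cscalar_prod_self assoc_mult_mat_vec[OF mat_adjoint_carrier[OF A] A v])

definition isometry_mat :: "nat \<Rightarrow> nat \<Rightarrow> complex mat \<Rightarrow> bool" where
  "isometry_mat n m W \<longleftrightarrow> W \<in> carrier_mat n m \<and> mat_adjoint W * W = 1\<^sub>m m"

lemma isometry_matD:
  assumes "isometry_mat n m W"
  shows "W \<in> carrier_mat n m" "mat_adjoint W \<in> carrier_mat m n" "mat_adjoint W * W = 1\<^sub>m m"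
  using assms by (auto simp: isometry_mat_def)

lemma vnorm_isometry:
  assumes W: "isometry_mat n m W" and v: "v \<in> carrier_vec m"
  shows "vnorm (W *\<^sub>v v) = vnorm v"
  using vnorm_mult_mat_vec_square[OF isometry_matD(1)[OF W] v] v
  by (simp add: isometry_matD(3)[OF W] cscalar_prod_self del: of_real_power)

lemma index_mult_mat_sum:
  assumes "A \<in> carrier_mat n m" "B \<in> carrier_mat m p" "i < n" "j < p"
  shows "(A * B) $$ (i, j) = (\<Sum>k<m. A $$ (i, k) * B $$ (k, j))"
  using assms by (simp add: scalar_prod_def lessThan_atLeast0)

lemma mtrace_mult_comm:
  assumes A: "A \<in> carrier_mat n m" and B: "B \<in> carrier_mat m n"
  shows "mtrace (A * B) = mtrace (B * A)"
proof -
  have "mtrace (A * B) = (\<Sum>i<n. \<Sum>k<m. A $$ (i, k) * B $$ (k, i))"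
    using A by (simp add: mtrace_def index_mult_mat_sum[OF A B] del: index_mult_mat(1))
  also have "\<dots> = (\<Sum>k<m. \<Sum>i<n. B $$ (k, i) * A $$ (i, k))"
    by (subst sum.swap) (simp add: mult.commute)
  also have "\<dots> = mtrace (B * A)"
    using B by (simp add: mtrace_def index_mult_mat_sum[OF B A] del: index_mult_mat(1))
  finally show ?thesis .
qed

lemma mtrace_add: "A \<in> carrier_mat n n \<Longrightarrow> B \<in> carrier_mat n n \<Longrightarrow> mtrace (A + B) = mtrace A + mtrace B"
  by (auto simp: mtrace_def sum.distrib)

lemma mtrace_minus: "A \<in> carrier_mat n n \<Longrightarrow> B \<in> carrier_mat n n \<Longrightarrow> mtrace (A - B) = mtrace A - mtrace B"
  by (auto simp: mtrace_def sum_subtractf)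

lemma mtrace_smult: "A \<in> carrier_mat n n \<Longrightarrow> mtrace (c \<cdot>\<^sub>m A) = c * mtrace A"
  by (auto simp: mtrace_def sum_distrib_left)

lemma mtrace_one: "mtrace (1\<^sub>m n) = of_nat n"
  by (simp add: mtrace_def)

lemma mtrace_mat_diag: "mtrace (mat_diag n d) = (\<Sum>i<n. d i)"
  by (simp add: mtrace_def mat_diag_def)

lemma mtrace_mult_adjoint:
  assumes V: "V \<in> carrier_mat n m"
  shows "mtrace (V * mat_adjoint V) = complex_of_real (\<Sum>j<m. (vnorm (col V j))\<^sup>2)"
proof -
  have "mtrace (V * mat_adjoint V) = (\<Sum>j<m. (mat_adjoint V * V) $$ (j, j))"
    using V unfolding mtrace_mult_comm[OF V mat_adjoint_carrier[OF V]] by (simp add: mtrace_def)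
  also have "\<dots> = (\<Sum>j<m. complex_of_real ((vnorm (col V j))\<^sup>2))"
    by (intro sum.cong refl) (simp add: index_adjoint_mult[OF V V] cscalar_prod_self)
  finally show ?thesis by simp
qed

section \<open>Bounded matrices\<close>

definition mat_bounded :: "real \<Rightarrow> complex mat \<Rightarrow> bool" where
  "mat_bounded c M \<longleftrightarrow> (\<forall>v\<in>carrier_vec (dim_col M). vnorm (M *\<^sub>v v) \<le> c * vnorm v)"

lemma mat_boundedD:
  "mat_bounded c M \<Longrightarrow> M \<in> carrier_mat n m \<Longrightarrow> v \<in> carrier_vec m \<Longrightarrow> vnorm (M *\<^sub>v v) \<le> c * vnorm v"
  by (simp add: mat_bounded_def)

lemma mat_bounded_one: "mat_bounded 1 (1\<^sub>m n)"
  by (simp add: mat_bounded_def)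

lemma mat_bounded_adjoint:
  assumes A: "A \<in> carrier_mat n m" and bounded: "mat_bounded c A" and c: "c \<ge> 0"
  shows "mat_bounded c (mat_adjoint A)"
  unfolding mat_bounded_def
proof
  fix w :: "complex vec" assume "w \<in> carrier_vec (dim_col (mat_adjoint A))"
  hence w: "w \<in> carrier_vec n" using A by simp
  let ?u = "mat_adjoint A *\<^sub>v w"
  have u: "?u \<in> carrier_vec m" by (rule mult_mat_vec_carrier[OF mat_adjoint_carrier[OF A] w])
  have "(vnorm ?u)\<^sup>2 = cmod ((A *\<^sub>v ?u) \<bullet>c w)"
    unfolding cscalar_prod_mult_mat_vec[OF A u w] cscalar_prod_self by (simp add: norm_power)
  also have "\<dots> \<le> vnorm (A *\<^sub>v ?u) * vnorm w" using A w by (intro norm_cscalar_prod_le) simp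
  also have "\<dots> \<le> (c * vnorm ?u) * vnorm w"
    by (intro mult_right_mono mat_boundedD[OF bounded A u]) simp
  finally have "vnorm ?u * vnorm ?u \<le> vnorm ?u * (c * vnorm w)" by (simp add: power2_eq_square ac_simps)
  thus "vnorm ?u \<le> c * vnorm w"
    using c vnorm_nonneg[of ?u] by (cases "vnorm ?u = 0") (simp_all add: mult_le_cancel_left)
qed

lemma mat_bounded_isometry_mult:
  assumes W: "isometry_mat n m W" and A: "A \<in> carrier_mat m p" "mat_bounded c A"
  shows "mat_bounded c (W * A)"
  unfolding mat_bounded_def
proof
  fix v :: "complex vec" assume "v \<in> carrier_vec (dim_col (W * A))"
  hence v: "v \<in> carrier_vec p" using A by simp
  have "vnorm (W * A *\<^sub>v v) = vnorm (A *\<^sub>v v)"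
    unfolding assoc_mult_mat_vec[OF isometry_matD(1)[OF W] A(1) v] using A v by (intro vnorm_isometry[OF W]) simp
  thus "vnorm (W * A *\<^sub>v v) \<le> c * vnorm v" using mat_boundedD[OF A(2,1) v] by simp
qed

lemma mat_bounded_mult_isometry:
  assumes A: "A \<in> carrier_mat n m" "mat_bounded c A" and W: "isometry_mat m p W"
  shows "mat_bounded c (A * W)"
  unfolding mat_bounded_def
proof
  fix v :: "complex vec" assume "v \<in> carrier_vec (dim_col (A * W))"
  hence v: "v \<in> carrier_vec p" using isometry_matD(1)[OF W] by simp
  show "vnorm (A * W *\<^sub>v v) \<le> c * vnorm v"
    using mat_boundedD[OF A(2,1) mult_mat_vec_carrier[OF isometry_matD(1)[OF W] v]]
    unfolding assoc_mult_mat_vec[OF A(1) isometry_matD(1)[OF W] v] vnorm_isometry[OF W v] .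
qed

lemma mat_bounded_sum_entries:
  assumes M: "M \<in> carrier_mat n m"
  shows "mat_bounded (\<Sum>i<n. \<Sum>j<m. cmod (M $$ (i, j))) M"
  unfolding mat_bounded_def
proof
  fix v :: "complex vec" assume "v \<in> carrier_vec (dim_col M)"
  hence v: "dim_vec v = m" using M by simp
  have "vnorm (M *\<^sub>v v) \<le> (\<Sum>i<n. cmod ((M *\<^sub>v v) $ i))"
    using M L2_set_le_sum[of "{..<n}" "\<lambda>i. cmod ((M *\<^sub>v v) $ i)"] by (simp add: vnorm_L2)
  also have "\<dots> \<le> (\<Sum>i<n. \<Sum>j<m. cmod (M $$ (i, j)) * vnorm v)"
    using M v norm_index_le_vnorm[of _ v]
    by (intro sum_mono)
      (auto simp: scalar_prod_def norm_mult atLeast0LessThan intro!: sum_norm_le mult_left_mono)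
  finally show "vnorm (M *\<^sub>v v) \<le> (\<Sum>i<n. \<Sum>j<m. cmod (M $$ (i, j))) * vnorm v"
    by (simp add: sum_distrib_right)
qed

lemma mat_bounded_op_norm: "mat_bounded (op_norm M) M"
  unfolding mat_bounded_def
proof
  fix v :: "complex vec" assume v: "v \<in> carrier_vec (dim_col M)"
  let ?S = "{vnorm (M *\<^sub>v u) | u. u \<in> carrier_vec (dim_col M) \<and> vnorm u = 1}"
  show "vnorm (M *\<^sub>v v) \<le> op_norm M * vnorm v"
  proof (cases "vnorm v = 0")
    case True
    hence "v = 0\<^sub>v (dim_col M)" using v by (simp add: vnorm_eq_0_iff)
    hence "vnorm (M *\<^sub>v v) = 0" by (simp add: vnorm_eq_0_iff mult_mat_zero_vec)
    thus ?thesis using True by simp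
  next
    case False
    define u where "u = complex_of_real (1 / vnorm v) \<cdot>\<^sub>v v"
    have "vnorm u = 1" using False by (simp add: u_def vnorm_smult norm_divide)
    hence "vnorm (M *\<^sub>v u) \<in> ?S" using v by (auto simp: u_def)
    moreover have "bdd_above ?S"
      using mat_bounded_sum_entries[OF carrier_matI[OF refl refl], of M]
      by (intro bdd_aboveI[of _ "\<Sum>i<dim_row M. \<Sum>j<dim_col M. cmod (M $$ (i, j))"])
        (force simp: mat_bounded_def)
    ultimately have "vnorm (M *\<^sub>v u) \<le> op_norm M"
      unfolding op_norm_def by (intro cSup_upper)
    moreover have "vnorm (M *\<^sub>v u) = vnorm (M *\<^sub>v v) / vnorm v"
      unfolding u_def mult_mat_vec[OF carrier_matI[OF refl refl] v] vnorm_smult by (simp add: norm_divide)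
    ultimately show ?thesis using False vnorm_nonneg[of v] by (simp add: divide_le_eq split: if_splits)
  qed
qed

lemma norm_mtrace_le:
  assumes X: "X \<in> carrier_mat n n" and bounded: "mat_bounded c X"
  shows "cmod (mtrace X) \<le> c * real n"
proof -
  have "cmod (X $$ (i, i)) \<le> c" if i: "i < n" for i
  proof -
    have "cmod (X $$ (i, i)) = cmod ((X *\<^sub>v unit_vec n i) $ i)" using X i by simp
    also have "\<dots> \<le> vnorm (X *\<^sub>v unit_vec n i)" using X i by (intro norm_index_le_vnorm) simp
    also have "\<dots> \<le> c * vnorm (unit_vec n i)" by (rule mat_boundedD[OF bounded X]) simp
    finally show ?thesis using i by (simp add: vnorm_unit_vec)
  qed
  hence "cmod (mtrace X) \<le> (\<Sum>i<n. c)"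
    unfolding mtrace_def carrier_matD(1)[OF X] by (intro sum_norm_le) auto
  thus ?thesis by (simp add: mult.commute)
qed

lemma norm_mtrace_mult_mult_adjoint_le:
  assumes M: "M \<in> carrier_mat n n" "mat_bounded c M" and V: "V \<in> carrier_mat n m"
  shows "cmod (mtrace (M * (V * mat_adjoint V))) \<le> c * cmod (mtrace (V * mat_adjoint V))"
proof -
  have V': "mat_adjoint V \<in> carrier_mat m n" and MV: "M * V \<in> carrier_mat n m" using M V by auto
  have "mtrace (M * (V * mat_adjoint V)) = mtrace (mat_adjoint V * (M * V))"
    unfolding assoc_mult_mat[OF M(1) V V', symmetric] by (rule mtrace_mult_comm[OF MV V'])
  also have "\<dots> = (\<Sum>j<m. (M *\<^sub>v col V j) \<bullet>c col V j)"
    using V by (auto simp: mtrace_def index_adjoint_mult[OF V MV] col_mult2[OF M(1) V]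
        simp del: index_mult_mat(1) intro!: sum.cong)
  also have "cmod \<dots> \<le> (\<Sum>j<m. c * (vnorm (col V j))\<^sup>2)"
  proof (intro sum_norm_le)
    fix j
    have v: "col V j \<in> carrier_vec n" using V by auto
    have "cmod ((M *\<^sub>v col V j) \<bullet>c col V j) \<le> vnorm (M *\<^sub>v col V j) * vnorm (col V j)"
      using M V by (intro norm_cscalar_prod_le) simp
    also have "\<dots> \<le> (c * vnorm (col V j)) * vnorm (col V j)"
      by (intro mult_right_mono mat_boundedD[OF M(2,1) v]) simp
    finally show "cmod ((M *\<^sub>v col V j) \<bullet>c col V j) \<le> c * (vnorm (col V j))\<^sup>2"
      by (simp add: power2_eq_square mult.assoc)
  qed
  also have "\<dots> = c * cmod (mtrace (V * mat_adjoint V))"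
    unfolding mtrace_mult_adjoint[OF V] norm_of_real by (simp add: sum_nonneg sum_distrib_left)
  finally show ?thesis .
qed

section \<open>Finite sums of matrices\<close>

definition mat_sum :: "nat \<Rightarrow> ('b \<Rightarrow> 'a :: comm_monoid_add mat) \<Rightarrow> 'b set \<Rightarrow> 'a mat" where
  "mat_sum N f A = mat N N (\<lambda>(i, j). \<Sum>a\<in>A. f a $$ (i, j))"

lemma mat_sum_carrier [simp]: "mat_sum N f A \<in> carrier_mat N N"
  by (simp add: mat_sum_def)

lemma mat_sum_index [simp]: "i < N \<Longrightarrow> j < N \<Longrightarrow> mat_sum N f A $$ (i, j) = (\<Sum>a\<in>A. f a $$ (i, j))"
  by (simp add: mat_sum_def)

lemma mat_sum_cong:
  "(\<And>a. a \<in> A \<Longrightarrow> f a = g a) \<Longrightarrow> mat_sum N f A = mat_sum N g A"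
  unfolding mat_sum_def by (intro cong_mat refl) (auto intro: sum.cong)

lemma mult_mat_sum:
  assumes B: "(B :: 'a :: semiring_0 mat) \<in> carrier_mat N N" and f: "\<And>a. a \<in> A \<Longrightarrow> f a \<in> carrier_mat N N"
  shows "B * mat_sum N f A = mat_sum N (\<lambda>a. B * f a) A"
proof (rule eq_matI)
  fix i j assume "i < dim_row (mat_sum N (\<lambda>a. B * f a) A)" "j < dim_col (mat_sum N (\<lambda>a. B * f a) A)"
  hence ij: "i < N" "j < N" by (auto simp: mat_sum_def)
  hence "(B * mat_sum N f A) $$ (i, j) = (\<Sum>k<N. \<Sum>a\<in>A. B $$ (i, k) * f a $$ (k, j))"
    by (simp add: index_mult_mat_sum[OF B mat_sum_carrier] sum_distrib_left del: index_mult_mat(1))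
  also have "\<dots> = (\<Sum>a\<in>A. (B * f a) $$ (i, j))"
    by (subst sum.swap) (simp add: index_mult_mat_sum[OF B f ij] del: index_mult_mat(1))
  finally show "(B * mat_sum N f A) $$ (i, j) = mat_sum N (\<lambda>a. B * f a) A $$ (i, j)" using ij by simp
qed (use B in \<open>auto simp: mat_sum_def\<close>)

lemma mat_sum_mult:
  assumes B: "(B :: 'a :: semiring_0 mat) \<in> carrier_mat N N" and f: "\<And>a. a \<in> A \<Longrightarrow> f a \<in> carrier_mat N N"
  shows "mat_sum N f A * B = mat_sum N (\<lambda>a. f a * B) A"
proof (rule eq_matI)
  fix i j assume "i < dim_row (mat_sum N (\<lambda>a. f a * B) A)" "j < dim_col (mat_sum N (\<lambda>a. f a * B) A)"
  hence ij: "i < N" "j < N" by (auto simp: mat_sum_def)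
  hence "(mat_sum N f A * B) $$ (i, j) = (\<Sum>k<N. \<Sum>a\<in>A. f a $$ (i, k) * B $$ (k, j))"
    by (simp add: index_mult_mat_sum[OF mat_sum_carrier B] sum_distrib_right del: index_mult_mat(1))
  also have "\<dots> = (\<Sum>a\<in>A. (f a * B) $$ (i, j))"
    by (subst sum.swap) (simp add: index_mult_mat_sum[OF f B ij] del: index_mult_mat(1))
  finally show "(mat_sum N f A * B) $$ (i, j) = mat_sum N (\<lambda>a. f a * B) A $$ (i, j)" using ij by simp
qed (use B in \<open>auto simp: mat_sum_def\<close>)

lemma smult_mat_sum:
  assumes "\<And>a. a \<in> A \<Longrightarrow> f a \<in> carrier_mat N N"
  shows "(c :: 'a :: semiring_0) \<cdot>\<^sub>m mat_sum N f A = mat_sum N (\<lambda>a. c \<cdot>\<^sub>m f a) A"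
proof (rule eq_matI)
  fix i j assume "i < dim_row (mat_sum N (\<lambda>a. c \<cdot>\<^sub>m f a) A)" "j < dim_col (mat_sum N (\<lambda>a. c \<cdot>\<^sub>m f a) A)"
  hence ij: "i < N" "j < N" by (auto simp: mat_sum_def)
  hence "(c \<cdot>\<^sub>m mat_sum N f A) $$ (i, j) = (\<Sum>a\<in>A. c * f a $$ (i, j))"
    by (simp add: mat_sum_def sum_distrib_left)
  also have "\<dots> = (\<Sum>a\<in>A. (c \<cdot>\<^sub>m f a) $$ (i, j))"
    using assms ij by (intro sum.cong refl) (simp add: carrier_matD[OF assms])
  finally show "(c \<cdot>\<^sub>m mat_sum N f A) $$ (i, j) = mat_sum N (\<lambda>a. c \<cdot>\<^sub>m f a) A $$ (i, j)" using ij by simp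
qed (auto simp: mat_sum_def)

lemma mtrace_mat_sum:
  assumes "\<And>a. a \<in> A \<Longrightarrow> f a \<in> carrier_mat N N"
  shows "mtrace (mat_sum N f A) = (\<Sum>a\<in>A. mtrace (f a))"
proof -
  have "mtrace (mat_sum N f A) = (\<Sum>a\<in>A. \<Sum>i<N. f a $$ (i, i))"
    unfolding mtrace_def by (subst sum.swap) (simp add: mat_sum_def)
  also have "\<dots> = (\<Sum>a\<in>A. mtrace (f a))"
    using assms by (intro sum.cong refl) (auto simp: mtrace_def)
  finally show ?thesis .
qed

lemma mat_sum_diff:
  fixes f :: "'b \<Rightarrow> 'a :: ab_group_add mat"
  assumes "finite A" "B \<subseteq> A"
  shows "mat_sum N f A - mat_sum N f B = mat_sum N f (A - B)"
  using assms by (intro eq_matI) (auto simp: mat_sum_def sum_diff)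

section \<open>Singular values\<close>

lemma smult_mat_mult_vec:
  fixes v :: "'a :: comm_semiring_0 vec"
  shows "A \<in> carrier_mat n m \<Longrightarrow> v \<in> carrier_vec m \<Longrightarrow> (c \<cdot>\<^sub>m A) *\<^sub>v v = c \<cdot>\<^sub>v (A *\<^sub>v v)"
  by (rule eq_vecI) auto

lemma mat_diag_mult_vec:
  "v \<in> carrier_vec n \<Longrightarrow> mat_diag n d *\<^sub>v v = vec n (\<lambda>i. d i * v $ i :: 'a :: semiring_0)"
  by (rule eq_vecI) (auto simp: mat_diag_def scalar_prod_def if_distrib[of "\<lambda>x. x * _"] cong: if_cong)

lemma exists_eigenvalue_neq:
  assumes A: "(A :: complex mat) \<in> carrier_mat n n" and tr: "mtrace A \<noteq> of_nat n * c"
  obtains e where "eigenvalue A e" "e \<noteq> c"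
proof -
  obtain es where es: "char_poly A = (\<Prod>a\<leftarrow>es. [:- a, 1:])" "length es = n"
    using char_poly_factorized[OF A] by blast
  obtain B P Q where "schur_decomposition A es = (B, P, Q)" by (cases "schur_decomposition A es")
  from schur_decomposition[OF A es(1) this] have sim: "similar_mat_wit A B P Q" and diag: "diag_mat B = es"
    by auto
  note w = similar_mat_witD2[OF A sim]
  have "mtrace A = mtrace (Q * (P * B))"
    unfolding w(3) by (rule mtrace_mult_comm[where n = n and m = n]) (use w in auto)
  also have "Q * (P * B) = B"
    unfolding assoc_mult_mat[OF w(7,6,5), symmetric] w(2) using w(5) by simp
  also have "mtrace B = sum_list es"
    by (simp add: mtrace_def diag_mat_def interv_sum_list_conv_sum_set_nat lessThan_atLeast0 flip: diag)
  finally have "sum_list es \<noteq> of_nat n * c" using tr by simp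
  hence "es \<noteq> replicate n c" by (auto simp: sum_list_replicate)
  then obtain e where e: "e \<in> set es" "e \<noteq> c" using es(2) by (metis replicate_eqI)
  have "eigenvalue A e"
    unfolding eigenvalue_root_char_poly[OF A] es(1) using e(1)
    by (auto simp: poly_prod_list prod_list_zero_iff)
  thus ?thesis using that e(2) by blast
qed

text \<open>If \<open>W\<^sup>* H = F W\<^sup>*\<close> and \<open>W\<^sup>* W = 1\<close>, the deflation \<open>K\<close> satisfies \<open>W\<^sup>* K = r W\<^sup>*\<close>, so its eigenvectors
  for eigenvalues other than \<open>r\<close> lie in the kernel of \<open>W\<^sup>*\<close>, where it agrees with \<open>H\<close>.\<close>
definition deflation :: "complex mat \<Rightarrow> complex mat \<Rightarrow> complex mat \<Rightarrow> complex \<Rightarrow> complex mat" where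
  "deflation H W F r = H + W * (r \<cdot>\<^sub>m 1\<^sub>m (dim_row F) - F) * mat_adjoint W"

lemma deflation_carrier:
  assumes "H \<in> carrier_mat n n" "W \<in> carrier_mat n k" "F \<in> carrier_mat k k"
  shows "deflation H W F r \<in> carrier_mat n n"
  using assms by (auto simp: deflation_def intro!: add_carrier_mat mult_carrier_mat[of _ n k])

lemma adjoint_mult_deflation:
  assumes H: "H \<in> carrier_mat n n" and "isometry_mat n k W"
    and F: "F \<in> carrier_mat k k" "mat_adjoint W * H = F * mat_adjoint W"
  shows "mat_adjoint W * deflation H W F r = r \<cdot>\<^sub>m mat_adjoint W"
proof -
  note W = isometry_matD[OF \<open>isometry_mat n k W\<close>]
  let ?W' = "mat_adjoint W" and ?R = "r \<cdot>\<^sub>m 1\<^sub>m k - F"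
  have R: "?R \<in> carrier_mat k k" using F by auto
  have WR: "W * ?R \<in> carrier_mat n k" by (rule mult_carrier_mat[OF W(1) R])
  have "?W' * deflation H W F r = ?W' * H + ?W' * (W * ?R * ?W')"
    unfolding deflation_def carrier_matD(1)[OF F(1)]
    by (rule mult_add_distrib_mat[OF W(2) H mult_carrier_mat[OF WR W(2)]])
  also have "?W' * (W * ?R * ?W') = (?W' * W) * (?R * ?W')"
    using assoc_mult_mat[OF W(1) R W(2)] assoc_mult_mat[OF W(2,1) mult_carrier_mat[OF R W(2)]] by simp
  also have "?W' * H + \<dots> = F * ?W' + (r \<cdot>\<^sub>m ?W' - F * ?W')"
    unfolding F(2) W(3) minus_mult_distrib_mat[OF smult_carrier_mat[OF one_carrier_mat] F(1) W(2)]
      mult_smult_assoc_mat[OF one_carrier_mat W(2)] left_mult_one_mat[OF W(2)]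
      left_mult_one_mat[OF minus_carrier_mat[OF mult_carrier_mat[OF F(1) W(2)]]] ..
  also have "\<dots> = r \<cdot>\<^sub>m ?W'" using W(2) F(1) by (intro eq_matI) (auto simp del: index_mult_mat(1))
  finally show ?thesis .
qed

lemma deflation_mult_kernel:
  assumes H: "H \<in> carrier_mat n n" and W: "W \<in> carrier_mat n k" and F: "F \<in> carrier_mat k k"
    and v: "v \<in> carrier_vec n" "mat_adjoint W *\<^sub>v v = 0\<^sub>v k"
  shows "deflation H W F r *\<^sub>v v = H *\<^sub>v v"
proof -
  let ?R = "r \<cdot>\<^sub>m 1\<^sub>m k - F"
  have W': "mat_adjoint W \<in> carrier_mat k n" and WR: "W * ?R \<in> carrier_mat n k" using W F by auto
  have "deflation H W F r *\<^sub>v v = H *\<^sub>v v + W * ?R *\<^sub>v 0\<^sub>v k"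
    unfolding deflation_def carrier_matD(1)[OF F] v(2)[symmetric] assoc_mult_mat_vec[OF WR W' v(1), symmetric]
    by (rule add_mult_distrib_mat_vec[OF H mult_carrier_mat[OF WR W'] v(1)])
  also have "W * ?R *\<^sub>v 0\<^sub>v k = 0\<^sub>v n"
    using mult_mat_zero_vec[of "W * ?R"] unfolding carrier_matD[OF WR] .
  also have "H *\<^sub>v v + 0\<^sub>v n = H *\<^sub>v v" by (rule right_zero_vec[OF mult_mat_vec_carrier[OF H v(1)]])
  finally show ?thesis .
qed

lemma mtrace_deflation:
  assumes H: "H \<in> carrier_mat n n" and "isometry_mat n k W" and F: "F \<in> carrier_mat k k"
  shows "mtrace (deflation H W F r) = mtrace H - mtrace F + of_nat k * r"
proof -
  note W = isometry_matD[OF \<open>isometry_mat n k W\<close>]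
  let ?R = "r \<cdot>\<^sub>m 1\<^sub>m k - F"
  have R: "?R \<in> carrier_mat k k" using F by auto
  have WR: "W * ?R \<in> carrier_mat n k" by (rule mult_carrier_mat[OF W(1) R])
  have "mtrace (W * ?R * mat_adjoint W) = mtrace ?R"
    unfolding mtrace_mult_comm[OF WR W(2)] assoc_mult_mat[OF W(2,1) R, symmetric] W(3)
      left_mult_one_mat[OF R] ..
  also have "\<dots> = r * of_nat k - mtrace F"
    unfolding mtrace_minus[OF smult_carrier_mat[OF one_carrier_mat] F] mtrace_smult[OF one_carrier_mat]
      mtrace_one ..
  finally show ?thesis
    unfolding deflation_def carrier_matD(1)[OF F] mtrace_add[OF H mult_carrier_mat[OF WR W(2)]] by simp
qed

lemma exists_unit_eigenvector_in_adjoint_kernel: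
  assumes H: "H \<in> carrier_mat n n" and isometry: "isometry_mat n k W"
    and F: "F \<in> carrier_mat k k" "mat_adjoint W * H = F * mat_adjoint W" and "k < n"
  obtains v e where "v \<in> carrier_vec n" "vnorm v = 1" "H *\<^sub>v v = e \<cdot>\<^sub>v v" "mat_adjoint W *\<^sub>v v = 0\<^sub>v k"
proof -
  note W = isometry_matD[OF isometry]
  let ?W' = "mat_adjoint W"
  define r where "r = (mtrace H - mtrace F) / of_nat (n - k) + 1"
  define K where "K = deflation H W F r"
  have K: "K \<in> carrier_mat n n" unfolding K_def by (rule deflation_carrier[OF H W(1) F(1)])
  have "of_nat (n - k) * r = mtrace H - mtrace F + of_nat (n - k)"
    using \<open>k < n\<close> by (simp add: r_def field_simps)
  hence "mtrace K = of_nat n * r - of_nat (n - k)"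
    using \<open>k < n\<close> unfolding K_def mtrace_deflation[OF H isometry F(1)] by (simp add: of_nat_diff algebra_simps)
  hence "mtrace K \<noteq> of_nat n * r" using \<open>k < n\<close> by simp
  then obtain e where "eigenvalue K e" "e \<noteq> r" by (rule exists_eigenvalue_neq[OF K])
  then obtain v where v: "v \<in> carrier_vec n" "v \<noteq> 0\<^sub>v n" "K *\<^sub>v v = e \<cdot>\<^sub>v v"
    using K unfolding eigenvalue_def eigenvector_def by auto
  have "r \<cdot>\<^sub>v (?W' *\<^sub>v v) = (?W' * K) *\<^sub>v v"
    unfolding K_def adjoint_mult_deflation[OF H isometry F] by (rule smult_mat_mult_vec[OF W(2) v(1), symmetric])
  also have "\<dots> = e \<cdot>\<^sub>v (?W' *\<^sub>v v)"
    unfolding assoc_mult_mat_vec[OF W(2) K v(1)] v(3) by (rule mult_mat_vec[OF W(2) v(1)])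
  finally have "(r - e) * (?W' *\<^sub>v v) $ i = 0" if "i < k" for i
    using W that by (simp add: vec_eq_iff algebra_simps del: index_mult_mat_vec)
  hence orth: "?W' *\<^sub>v v = 0\<^sub>v k"
    using W v \<open>e \<noteq> r\<close> by (intro eq_vecI) auto
  have ev: "H *\<^sub>v v = e \<cdot>\<^sub>v v"
    using deflation_mult_kernel[OF H W(1) F(1) v(1) orth, of r] v(3) by (simp add: K_def)
  let ?u = "complex_of_real (1 / vnorm v) \<cdot>\<^sub>v v"
  have "vnorm ?u = 1" using v by (simp add: vnorm_smult norm_divide vnorm_eq_0_iff)
  moreover have "?W' *\<^sub>v ?u = 0\<^sub>v k" unfolding mult_mat_vec[OF W(2) v(1)] orth by (rule eq_vecI) auto
  ultimately show thesis
    using v(1) ev mult_mat_vec[OF H v(1)]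
    by (intro that[of ?u e]) (simp_all add: smult_smult_assoc mult.commute)
qed

definition append_col :: "'a mat \<Rightarrow> 'a vec \<Rightarrow> 'a mat" where
  "append_col A v = mat (dim_row A) (Suc (dim_col A)) (\<lambda>(i, j). if j < dim_col A then A $$ (i, j) else v $ i)"

lemma append_col_carrier [simp]: "A \<in> carrier_mat n k \<Longrightarrow> append_col A v \<in> carrier_mat n (Suc k)"
  by (simp add: append_col_def)

lemma col_append_col:
  "A \<in> carrier_mat n k \<Longrightarrow> v \<in> carrier_vec n \<Longrightarrow> j < Suc k \<Longrightarrow>
    col (append_col A v) j = (if j < k then col A j else v)"
  by (rule eq_vecI) (auto simp: append_col_def)

lemma isometry_append_col:
  assumes isometry: "isometry_mat n k W" and v: "v \<in> carrier_vec n" "vnorm v = 1" "mat_adjoint W *\<^sub>v v = 0\<^sub>v k"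
  shows "isometry_mat n (Suc k) (append_col W v)"
proof -
  note W = isometry_matD[OF isometry]
  let ?X = "append_col W v"
  have X: "?X \<in> carrier_mat n (Suc k)" using W by simp
  have col_W: "col W i \<in> carrier_vec n" for i using W by auto
  have WW: "col W j \<bullet>c col W i = (if i = j then 1 else 0)" if "i < k" "j < k" for i j
    using that by (simp add: W(3) flip: index_adjoint_mult[OF W(1) W(1)])
  have vW: "v \<bullet>c col W i = 0" if "i < k" for i
    using that by (simp add: v(3) flip: index_adjoint_mult_vec[OF W(1) v(1)])
  have Wv: "col W i \<bullet>c v = 0" if "i < k" for i
    using vW[OF that] conjugate_conjugate_sprod[OF col_W v(1), of i]
      conjugate_vec_sprod_comm[OF v(1) col_W, of i] by simp
  have "mat_adjoint ?X * ?X = 1\<^sub>m (Suc k)"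
  proof (rule eq_matI)
    fix i j assume "i < dim_row (1\<^sub>m (Suc k) :: complex mat)" "j < dim_col (1\<^sub>m (Suc k) :: complex mat)"
    hence ij: "i < Suc k" "j < Suc k" by auto
    thus "(mat_adjoint ?X * ?X) $$ (i, j) = 1\<^sub>m (Suc k) $$ (i, j)"
      using v(2) unfolding index_adjoint_mult[OF X X ij] col_append_col[OF W(1) v(1) ij(1)]
        col_append_col[OF W(1) v(1) ij(2)]
      by (auto simp: WW vW Wv cscalar_prod_self[of v] less_Suc_eq)
  qed (use X in auto)
  thus ?thesis using X by (simp add: isometry_mat_def)
qed

lemma col_mult_mat_diag:
  "A \<in> carrier_mat n m \<Longrightarrow> j < m \<Longrightarrow> col (A * mat_diag m d) j = d j \<cdot>\<^sub>v col (A :: 'a :: comm_semiring_1 mat) j"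
  by (rule eq_vecI) (auto simp: mat_diag_mult_right mult.commute)

lemma hermitian_orthonormal_eigenvectors:
  assumes H: "(H :: complex mat) \<in> carrier_mat n n" "mat_adjoint H = H" and "k \<le> n"
  shows "\<exists>W \<mu>. isometry_mat n k W \<and> H * W = W * mat_diag k \<mu>"
  using \<open>k \<le> n\<close>
proof (induction k)
  case 0
  show ?case
    using H(1) by (intro exI[of _ "0\<^sub>m n 0"] exI[of _ "\<lambda>_. 0"])
      (auto simp: isometry_mat_def mat_diag_def intro!: eq_matI)
next
  case (Suc k)
  then obtain W \<mu> where isometry: "isometry_mat n k W" and HW: "H * W = W * mat_diag k \<mu>" by auto
  note W = isometry_matD[OF isometry]
  let ?D = "mat_adjoint (mat_diag k \<mu>)"
  have "mat_adjoint W * H = ?D * mat_adjoint W"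
    using arg_cong[OF HW, of mat_adjoint] H(2)
    by (simp add: mat_adjoint_mult[OF H(1) W(1)] mat_adjoint_mult[OF W(1) mat_diag_dim])
  then obtain v e where v: "v \<in> carrier_vec n" "vnorm v = 1" "H *\<^sub>v v = e \<cdot>\<^sub>v v"
    and orth: "mat_adjoint W *\<^sub>v v = 0\<^sub>v k"
    using exists_unit_eigenvector_in_adjoint_kernel[OF H(1) isometry mat_adjoint_carrier[OF mat_diag_dim]]
      Suc.prems by auto
  let ?X = "append_col W v"
  have X: "?X \<in> carrier_mat n (Suc k)" using W by simp
  have "H * ?X = ?X * mat_diag (Suc k) (\<mu>(k := e))"
  proof (rule mat_col_eqI)
    fix j assume "j < dim_col (?X * mat_diag (Suc k) (\<mu>(k := e)))"
    hence j: "j < Suc k" by (simp add: mat_diag_def)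
    have "col (H * ?X) j = (\<mu>(k := e)) j \<cdot>\<^sub>v col ?X j"
      using j v(3) col_mult2[OF H(1) W(1), of j]
      unfolding HW col_mult2[OF H(1) X j] col_append_col[OF W(1) v(1) j]
      by (auto simp: col_mult_mat_diag[OF W(1)] less_Suc_eq)
    thus "col (H * ?X) j = col (?X * mat_diag (Suc k) (\<mu>(k := e))) j"
      using col_mult_mat_diag[OF X j] by simp
  qed (use H X in \<open>auto simp: mat_diag_def\<close>)
  thus ?case using isometry_append_col[OF isometry v(1,2) orth] by blast
qed

abbreviation unitary_mat :: "nat \<Rightarrow> complex mat \<Rightarrow> bool" where
  "unitary_mat n \<equiv> isometry_mat n n"

lemma unitary_mult_adjoint: "unitary_mat n W \<Longrightarrow> W * mat_adjoint W = 1\<^sub>m n"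
  using mat_mult_left_right_inverse[of "mat_adjoint W" n W] by (simp add: isometry_matD)

lemma unitary_unconjugate:
  assumes "unitary_mat n W" and D: "D \<in> carrier_mat n n"
  shows "mat_adjoint W * (W * D * mat_adjoint W) * W = D"
proof -
  note W = isometry_matD[OF \<open>unitary_mat n W\<close>]
  have "mat_adjoint W * (W * D * mat_adjoint W) * W = (mat_adjoint W * W) * D * (mat_adjoint W * W)"
    using W(1,2) D by (simp add: assoc_mult_mat[of _ n n _ n _ n] mult_carrier_mat[of _ n n])
  thus ?thesis using D by (simp add: W(3))
qed

lemma hermitian_diagonalization:
  assumes H: "(H :: complex mat) \<in> carrier_mat n n" "mat_adjoint H = H"
  obtains W \<mu> where "unitary_mat n W" "H = W * mat_diag n \<mu> * mat_adjoint W"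
proof -
  obtain W \<mu> where W: "unitary_mat n W" and HW: "H * W = W * mat_diag n \<mu>"
    using hermitian_orthonormal_eigenvectors[OF H order_refl] by auto
  have "H = H * W * mat_adjoint W"
    using H(1) by (simp add: assoc_mult_mat[OF H(1) isometry_matD(1,2)[OF W]] unitary_mult_adjoint[OF W])
  thus thesis using that W by (simp only: HW)
qed

lemma det_mat_diag: "det (mat_diag n d) = (\<Prod>i<n. d i)"
  by (subst det_upper_triangular[OF _ mat_diag_dim])
    (auto simp: mat_diag_def prod_list_diag_prod lessThan_atLeast0 intro!: prod.cong)

lemma char_poly_mat_diag: "char_poly (mat_diag n d) = (\<Prod>i<n. [:- d i, 1:])"
  by (subst char_poly_upper_triangular[OF mat_diag_dim])
    (auto simp: mat_diag_def diag_mat_def o_def lessThan_atLeast0 prod.list_conv_set_nth intro!: prod.cong)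

lemma adjoint_mult_self_diagonalization:
  assumes M: "M \<in> carrier_mat m n"
  obtains W s where "unitary_mat n W" "\<And>i. s i \<ge> 0"
    "mat_adjoint M * M = W * mat_diag n (\<lambda>i. complex_of_real ((s i)\<^sup>2)) * mat_adjoint W"
proof -
  let ?H = "mat_adjoint M * M"
  have M': "mat_adjoint M \<in> carrier_mat n m" and H: "?H \<in> carrier_mat n n" using M by auto
  have "mat_adjoint ?H = ?H" by (simp add: mat_adjoint_mult[OF M' M])
  then obtain W \<mu> where W: "unitary_mat n W" and HW: "?H = W * mat_diag n \<mu> * mat_adjoint W"
    using hermitian_diagonalization[OF H] by metis
  define s where "s i = vnorm (col (M * W) i)" for i
  have MW: "M * W \<in> carrier_mat m n" using M isometry_matD(1)[OF W] by auto
  have "mat_adjoint (M * W) * (M * W) = mat_diag n \<mu>"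
    unfolding adjoint_mult_self_mult[OF M isometry_matD(1)[OF W]] HW by (rule unitary_unconjugate[OF W mat_diag_dim])
  hence "mat_diag n \<mu> $$ (i, i) = col (M * W) i \<bullet>c col (M * W) i" if "i < n" for i
    using index_adjoint_mult[OF MW MW that that] by simp
  hence "\<mu> i = complex_of_real ((s i)\<^sup>2)" if "i < n" for i
    using that unfolding s_def by (simp only: cscalar_prod_self) (simp add: mat_diag_def)
  hence "mat_diag n \<mu> = mat_diag n (\<lambda>i. complex_of_real ((s i)\<^sup>2))"
    by (intro eq_matI) (auto simp: mat_diag_def)
  thus thesis using that[of W s] W HW by (simp add: s_def)
qed

section \<open>The trace norm\<close>

lemma similar_mat_unitary_conjugate:
  assumes "unitary_mat n W" "D \<in> carrier_mat n n"
  shows "similar_mat (W * D * mat_adjoint W) D"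
  unfolding similar_mat_def
  using isometry_matD[OF assms(1)] unitary_mult_adjoint[OF assms(1)] assms(2)
  by (intro exI[of _ W] exI[of _ "mat_adjoint W"] similar_mat_witI[of _ _ n])
    (auto intro!: mult_carrier_mat[of _ n n])

lemma proots_prod_linear:
  "finite A \<Longrightarrow> proots (\<Prod>i\<in>A. [:- d i, 1:]) = image_mset d (mset_set A)"
  by (induction A rule: finite_induct) (simp_all add: proots_mult del: mult_pCons_left)

lemma trace_norm_eq_sum:
  assumes W: "unitary_mat n W" and s: "\<And>i. s i \<ge> 0"
    and M: "mat_adjoint M * M = W * mat_diag n (\<lambda>i. complex_of_real ((s i)\<^sup>2)) * mat_adjoint W"
  shows "trace_norm M = (\<Sum>i<n. s i)"
proof -
  have "char_poly (mat_adjoint M * M) = (\<Prod>i<n. [:- complex_of_real ((s i)\<^sup>2), 1:])"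
    unfolding M char_poly_similar[OF similar_mat_unitary_conjugate[OF W mat_diag_dim]]
    by (rule char_poly_mat_diag)
  thus ?thesis
    using s by (simp add: trace_norm_def proots_prod_linear image_mset.compositionality o_def
        sum_unfold_sum_mset del: of_real_power)
qed

lemma normalized_orthogonal_columns:
  fixes s :: "nat \<Rightarrow> real"
  assumes Z: "Z \<in> carrier_mat m n"
    and gram: "mat_adjoint Z * Z = mat_diag n (\<lambda>i. complex_of_real ((s i)\<^sup>2))"
  obtains Y where "Y \<in> carrier_mat m n" "mat_bounded 1 Y"
    "mat_adjoint Y * Z = mat_diag n (\<lambda>i. complex_of_real (s i))"
proof -
  \<comment> \<open>\<open>inverse 0 = 0\<close> keeps the zero columns.\<close>
  let ?D = "mat_diag n (\<lambda>i. complex_of_real (inverse (s i)))"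
  define Y where "Y = Z * ?D"
  have Y: "Y \<in> carrier_mat m n" using Z by (simp add: Y_def)
  have Z': "mat_adjoint Z \<in> carrier_mat n m" using Z by simp
  have Y': "mat_adjoint Y = ?D * mat_adjoint Z"
    unfolding Y_def mat_adjoint_mult[OF Z mat_diag_dim] mat_adjoint_mat_diag by simp
  have YZ: "mat_adjoint Y * Z = mat_diag n (\<lambda>i. complex_of_real (s i))"
    unfolding Y' assoc_mult_mat[OF mat_diag_dim Z' Z] gram mat_diag_diag
    by (intro eq_matI) (auto simp: mat_diag_def power2_eq_square field_simps)
  define q :: "nat \<Rightarrow> real" where "q i = of_bool (s i \<noteq> 0)" for i
  have "mat_adjoint Y * Y = mat_adjoint Y * Z * ?D"
    unfolding assoc_mult_mat[OF mat_adjoint_carrier[OF Y] Z mat_diag_dim] Y_def[symmetric] ..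
  also have "\<dots> = mat_diag n (\<lambda>i. complex_of_real (q i))"
    unfolding YZ mat_diag_diag by (intro eq_matI) (auto simp: mat_diag_def q_def)
  finally have YY: "mat_adjoint Y * Y = mat_diag n (\<lambda>i. complex_of_real (q i))" .
  have "mat_bounded 1 Y"
    unfolding mat_bounded_def
  proof
    fix v :: "complex vec" assume "v \<in> carrier_vec (dim_col Y)"
    hence v: "v \<in> carrier_vec n" using Y by simp
    have "complex_of_real ((vnorm (Y *\<^sub>v v))\<^sup>2) = complex_of_real (\<Sum>i<n. q i * (cmod (v $ i))\<^sup>2)"
      unfolding vnorm_mult_mat_vec_square[OF Y v] YY mat_diag_mult_vec[OF v]
      using v by (simp add: cscalar_prod_sum[of _ n] complex_norm_square mult.left_commute del: of_real_power)
    hence "(vnorm (Y *\<^sub>v v))\<^sup>2 = (\<Sum>i<n. q i * (cmod (v $ i))\<^sup>2)" by (simp only: of_real_eq_iff)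
    also have "\<dots> \<le> (\<Sum>i<n. (cmod (v $ i))\<^sup>2)" by (intro sum_mono) (simp add: q_def)
    also have "\<dots> = (vnorm v)\<^sup>2" using v by (simp add: vnorm_def sum_nonneg)
    finally show "vnorm (Y *\<^sub>v v) \<le> 1 * vnorm v"
      unfolding mult_1 by (rule power2_le_imp_le) simp
  qed
  thus thesis using that Y YZ by blast
qed

lemma trace_norm_attained:
  assumes M: "M \<in> carrier_mat n n"
  obtains U where "U \<in> carrier_mat n n" "mat_bounded 1 U" "mtrace (U * M) = complex_of_real (trace_norm M)"
proof -
  obtain W s where unitary: "unitary_mat n W" and s: "\<And>i. s i \<ge> 0"
    and gram: "mat_adjoint M * M = W * mat_diag n (\<lambda>i. complex_of_real ((s i)\<^sup>2)) * mat_adjoint W"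
    using adjoint_mult_self_diagonalization[OF M] by metis
  note W = isometry_matD[OF unitary]
  have MW: "M * W \<in> carrier_mat n n" using M W by auto
  have "mat_adjoint (M * W) * (M * W) = mat_diag n (\<lambda>i. complex_of_real ((s i)\<^sup>2))"
    unfolding adjoint_mult_self_mult[OF M W(1)] gram by (rule unitary_unconjugate[OF unitary mat_diag_dim])
  then obtain Y where Y: "Y \<in> carrier_mat n n" "mat_bounded 1 Y"
    and YMW: "mat_adjoint Y * (M * W) = mat_diag n (\<lambda>i. complex_of_real (s i))"
    by (rule normalized_orthogonal_columns[OF MW])
  have Y': "mat_adjoint Y \<in> carrier_mat n n" using Y by simp
  have "mtrace (W * mat_adjoint Y * M) = mtrace (mat_adjoint Y * (M * W))"
    unfolding assoc_mult_mat[OF W(1) Y' M] assoc_mult_mat[OF Y' M W(1), symmetric]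
    by (rule mtrace_mult_comm[OF W(1) mult_carrier_mat[OF Y' M]])
  also have "\<dots> = complex_of_real (trace_norm M)"
    unfolding YMW mtrace_mat_diag trace_norm_eq_sum[OF unitary s gram] by simp
  finally show thesis
    using mat_bounded_isometry_mult[OF unitary Y' mat_bounded_adjoint[OF Y]] mult_carrier_mat[OF W(1) Y']
    by (intro that) auto
qed

lemma trace_norm_le:
  assumes "M \<in> carrier_mat n n"
    and "\<And>U. U \<in> carrier_mat n n \<Longrightarrow> mat_bounded 1 U \<Longrightarrow> cmod (mtrace (U * M)) \<le> c"
  shows "trace_norm M \<le> c"
proof -
  obtain U where "U \<in> carrier_mat n n" "mat_bounded 1 U" "mtrace (U * M) = complex_of_real (trace_norm M)"
    using trace_norm_attained[OF assms(1)] .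
  thus ?thesis using assms(2)[of U] by simp
qed

lemma sum_ge_card_if_prod_eq_1:
  fixes f :: "'a \<Rightarrow> real"
  assumes "finite A" and "\<And>i. i \<in> A \<Longrightarrow> f i \<ge> 0" and "prod f A = 1"
  shows "real (card A) \<le> sum f A"
proof -
  have pos: "f i > 0" if "i \<in> A" for i
    using assms that by (metis order_le_less prod_zero zero_neq_one)
  have "0 = ln (prod f A)" by (simp add: assms(3))
  also have "\<dots> = (\<Sum>i\<in>A. ln (f i))" using assms(1) pos by (intro ln_prod) force+
  also have "\<dots> \<le> (\<Sum>i\<in>A. f i - 1)" by (intro sum_mono ln_le_minus_one pos)
  finally show ?thesis by (simp add: sum_subtractf)
qed

lemma mtrace_mult_adjoint_ge_dim:
  assumes V: "V \<in> carrier_mat n n" and det: "det (V * mat_adjoint V) = 1"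
  shows "cmod (mtrace (V * mat_adjoint V)) \<ge> real n"
proof -
  obtain W s where unitary: "unitary_mat n W"
    and gram: "V * mat_adjoint V = W * mat_diag n (\<lambda>i. complex_of_real ((s i)\<^sup>2)) * mat_adjoint W"
    using adjoint_mult_self_diagonalization[OF mat_adjoint_carrier[OF V]] by (metis mat_adjoint_mat_adjoint)
  let ?D = "mat_diag n (\<lambda>i. complex_of_real ((s i)\<^sup>2))"
  note W = isometry_matD[OF unitary]
  have WD: "W * ?D \<in> carrier_mat n n" using W(1) by auto
  have "mtrace (V * mat_adjoint V) = mtrace ?D"
    unfolding gram mtrace_mult_comm[OF WD W(2)] assoc_mult_mat[OF W(2,1) mat_diag_dim, symmetric] W(3)
      left_mult_one_mat[OF mat_diag_dim] ..
  hence tr: "mtrace (V * mat_adjoint V) = complex_of_real (\<Sum>i<n. (s i)\<^sup>2)"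
    by (simp add: mtrace_mat_diag)
  have "complex_of_real (\<Prod>i<n. (s i)\<^sup>2) = 1"
    using det det_similar[OF similar_mat_unitary_conjugate[OF unitary mat_diag_dim]] unfolding gram
    by (simp add: det_mat_diag)
  hence "(\<Prod>i<n. (s i)\<^sup>2) = 1" by (simp only: of_real_eq_1_iff)
  hence "real (card {..<n}) \<le> (\<Sum>i<n. (s i)\<^sup>2)" by (intro sum_ge_card_if_prod_eq_1) auto
  thus ?thesis unfolding tr by (simp add: sum_nonneg del: of_real_sum of_real_power)
qed

section \<open>Multiplication of Pauli strings\<close>

text \<open>For distinct non-identity Paulis \<open>c\<close>, \<open>d\<close> the product is, up to phase, the third one,
  whose index is \<open>6 - c - d\<close>.\<close>
definition pauli_mult :: "nat \<Rightarrow> nat \<Rightarrow> nat" where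
  "pauli_mult c d = (if c = d then 0 else if c = 0 then d else if d = 0 then c else 6 - c - d)"

definition pauli_phase :: "nat \<Rightarrow> nat \<Rightarrow> complex" where
  "pauli_phase c d = (if c = d \<or> c = 0 \<or> d = 0 then 1
     else if (c = 1 \<and> d = 2) \<or> (c = 2 \<and> d = 3) \<or> (c = 3 \<and> d = 1) then \<i> else - \<i>)"

lemma less_4_cases: "(c::nat) < 4 \<Longrightarrow> c = 0 \<or> c = 1 \<or> c = 2 \<or> c = 3"
  by auto

lemma sigma_mult:
  assumes "c < 4" "d < 4" "a < 2" "b < 2"
  shows "sigma c a 0 * sigma d 0 b + sigma c a 1 * sigma d 1 b
    = pauli_phase c d * sigma (pauli_mult c d) a b"
proof -
  have "a = 0 \<or> a = 1" "b = 0 \<or> b = 1" using assms by auto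
  with less_4_cases[OF assms(1)] less_4_cases[OF assms(2)] show ?thesis
    by (elim disjE; simp add: sigma_def pauli_phase_def pauli_mult_def)
qed

lemma cnj_sigma: "cnj (sigma c b a) = sigma c a b"
  by (simp add: sigma_def)

lemma pauli_mult_less: "c < 4 \<Longrightarrow> d < 4 \<Longrightarrow> pauli_mult c d < 4"
  by (auto simp: pauli_mult_def)

lemma pauli_mult_commute: "pauli_mult c d = pauli_mult d c"
  by (simp add: pauli_mult_def add.commute)

lemma pauli_phase_swap: "c < 4 \<Longrightarrow> d < 4 \<Longrightarrow> pauli_phase d c = cnj (pauli_phase c d)"
  by (drule less_4_cases, drule less_4_cases, elim disjE) (simp_all add: pauli_phase_def)

lemma pauli_mult_eq_0_iff: "c < 4 \<Longrightarrow> d < 4 \<Longrightarrow> pauli_mult c d = 0 \<longleftrightarrow> c = d"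
  by (auto simp: pauli_mult_def)

lemma pauli_mult_eq_right_iff: "c < 4 \<Longrightarrow> d < 4 \<Longrightarrow> pauli_mult c d = d \<longleftrightarrow> c = 0"
  by (drule less_4_cases, drule less_4_cases, elim disjE) (simp_all add: pauli_mult_def)

definition string_mult :: "(nat \<Rightarrow> nat) \<Rightarrow> (nat \<Rightarrow> nat) \<Rightarrow> nat \<Rightarrow> nat" where
  "string_mult p q = (\<lambda>i. pauli_mult (p i) (q i))"

definition string_phase :: "nat \<Rightarrow> (nat \<Rightarrow> nat) \<Rightarrow> (nat \<Rightarrow> nat) \<Rightarrow> complex" where
  "string_phase n p q = (\<Prod>i<n. pauli_phase (p i) (q i))"

text \<open>The entries of \<open>pmat\<close> without bounds on the indices, for inductions on \<open>n\<close>.\<close>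
definition string_entry :: "nat \<Rightarrow> (nat \<Rightarrow> nat) \<Rightarrow> nat \<Rightarrow> nat \<Rightarrow> complex" where
  "string_entry n p i j = (\<Prod>q<n. sigma (p q) (i div 2^q mod 2) (j div 2^q mod 2))"

lemma pmat_carrier [simp]: "pmat n p \<in> carrier_mat (2^n) (2^n)"
  by (simp add: pmat_def)

lemma pmat_dim [simp]: "dim_row (pmat n p) = 2^n" "dim_col (pmat n p) = 2^n"
  by (simp_all add: pmat_def)

lemma pmat_index: "i < 2^n \<Longrightarrow> j < 2^n \<Longrightarrow> pmat n p $$ (i, j) = string_entry n p i j"
  by (simp add: pmat_def string_entry_def)

lemma string_entry_Suc:
  "string_entry (Suc n) p i j = string_entry n p i j * sigma (p n) (i div 2^n mod 2) (j div 2^n mod 2)"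
  by (simp add: string_entry_def)

lemma add_power_div_power_mod_2:
  assumes "q < n"
  shows "(2^n + k) div 2^q mod 2 = k div 2^q mod (2::nat)"
proof -
  obtain m where "n = Suc (q + m)" using assms less_iff_Suc_add by blast
  hence "2^n + k = k + 2^q * (2 * 2^m)" by (simp add: power_add)
  thus ?thesis by (simp only: div_mult_self2) simp
qed

lemma string_entry_add_power:
  "string_entry n p (2^n + i) j = string_entry n p i j"
  "string_entry n p i (2^n + j) = string_entry n p i j"
  by (simp_all add: string_entry_def add_power_div_power_mod_2)

lemma sum_lessThan_power_Suc:
  "(\<Sum>k<2 ^ Suc n. f k) = (\<Sum>k<2^n. f k) + (\<Sum>k<2^n. f (2^n + k :: nat) :: 'a :: comm_monoid_add)"
  using sum.atLeastLessThan_concat[of 0 "2^n" "2^n + 2^n" f] sum.shift_bounds_nat_ivl[of f 0 "2^n" "2^n"]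
  by (simp add: mult_2 add.commute atLeast0LessThan)

lemma string_entry_mult:
  assumes "\<And>q. q < n \<Longrightarrow> p q < 4 \<and> r q < 4"
  shows "(\<Sum>k<2^n. string_entry n p i k * string_entry n r k j)
    = string_phase n p r * string_entry n (string_mult p r) i j"
  using assms
proof (induction n)
  case 0
  show ?case by (simp add: string_entry_def string_phase_def)
next
  case (Suc n)
  let ?a = "i div 2^n mod 2" and ?b = "j div 2^n mod 2"
  let ?S = "\<Sum>k<2^n. string_entry n p i k * string_entry n r k j"
  have "(\<Sum>k<2 ^ Suc n. string_entry (Suc n) p i k * string_entry (Suc n) r k j)
    = ?S * (sigma (p n) ?a 0 * sigma (r n) 0 ?b) + ?S * (sigma (p n) ?a 1 * sigma (r n) 1 ?b)"
    unfolding sum_lessThan_power_Suc sum_distrib_right string_entry_Suc string_entry_add_power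
    by (intro arg_cong2[where f = "(+)"] sum.cong refl) (simp_all add: ac_simps)
  also have "\<dots> = ?S * (sigma (p n) ?a 0 * sigma (r n) 0 ?b + sigma (p n) ?a 1 * sigma (r n) 1 ?b)"
    by (simp only: distrib_left)
  also have "\<dots> = ?S * (pauli_phase (p n) (r n) * sigma (string_mult p r n) ?a ?b)"
    unfolding string_mult_def using Suc.prems[of n] by (subst sigma_mult) auto
  also have "?S = string_phase n p r * string_entry n (string_mult p r) i j"
    using Suc by simp
  finally show ?case by (simp add: string_phase_def string_entry_Suc)
qed

lemma paulis_less: "p \<in> paulis n \<Longrightarrow> p q < 4"
  by (cases "q < n") (auto simp: paulis_def)

lemma string_mult_paulis: "p \<in> paulis n \<Longrightarrow> q \<in> paulis n \<Longrightarrow> string_mult p q \<in> paulis n"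
  by (auto simp: paulis_def string_mult_def pauli_mult_less) (simp add: pauli_mult_def)

lemma string_mult_commute: "string_mult p q = string_mult q p"
  by (simp add: string_mult_def pauli_mult_commute)

lemma string_mult_self: "string_mult p p = pauli_id"
  by (simp add: string_mult_def pauli_id_def pauli_mult_def)

lemma string_phase_self: "string_phase n p p = 1"
  by (simp add: string_phase_def pauli_phase_def)

lemma string_phase_swap:
  assumes p: "p \<in> paulis n" and q: "q \<in> paulis n"
  shows "string_phase n q p = cnj (string_phase n p q)"
  unfolding string_phase_def cnj_prod
  by (intro prod.cong refl pauli_phase_swap paulis_less[OF p] paulis_less[OF q])

lemma string_phase_cases: "string_phase n p q \<in> {1, -1, \<i>, -\<i>}"
proof (induction n)
  case (Suc n)
  have "pauli_phase (p n) (q n) \<in> {1, \<i>, -\<i>}" by (simp add: pauli_phase_def)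
  with Suc show ?case by (auto simp: string_phase_def)
qed (simp add: string_phase_def)

lemma pmat_mult:
  assumes p: "p \<in> paulis n" and q: "q \<in> paulis n"
  shows "pmat n p * pmat n q = string_phase n p q \<cdot>\<^sub>m pmat n (string_mult p q)"
proof (rule eq_matI)
  fix i j assume "i < dim_row (string_phase n p q \<cdot>\<^sub>m pmat n (string_mult p q))"
    "j < dim_col (string_phase n p q \<cdot>\<^sub>m pmat n (string_mult p q))"
  hence ij: "i < 2^n" "j < 2^n" by (auto simp: pmat_def)
  show "(pmat n p * pmat n q) $$ (i, j) = (string_phase n p q \<cdot>\<^sub>m pmat n (string_mult p q)) $$ (i, j)"
    using ij string_entry_mult[of n p q i j] paulis_less[OF p] paulis_less[OF q]
    by (simp add: scalar_prod_def pmat_index atLeast0LessThan)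
qed (auto simp: pmat_def)

lemma pmat_id: "pmat n pauli_id = 1\<^sub>m (2^n)"
proof (rule eq_matI)
  fix i j assume "i < dim_row (1\<^sub>m (2^n) :: complex mat)" "j < dim_col (1\<^sub>m (2^n) :: complex mat)"
  hence ij: "i < 2^n" "j < 2^n" by auto
  show "pmat n pauli_id $$ (i, j) = 1\<^sub>m (2^n) $$ (i, j)"
  proof (cases "i = j")
    case True
    thus ?thesis using ij by (simp add: pmat_index string_entry_def pauli_id_def sigma_def)
  next
    case False
    then obtain q where q: "bit i q \<noteq> bit j q" using bit_eqI by blast
    hence "q < n" using ij by (metis bit_take_bit_iff take_bit_nat_eq_self)
    moreover have "i div 2^q mod 2 \<noteq> j div 2^q mod 2"
      using q by (auto simp: bit_iff_odd odd_iff_mod_2_eq_one)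
    ultimately have "string_entry n pauli_id i j = 0"
      by (auto simp: string_entry_def pauli_id_def sigma_def)
    thus ?thesis using ij False by (simp add: pmat_index)
  qed
qed (auto simp: pmat_def)

lemma mat_adjoint_pmat: "mat_adjoint (pmat n p) = pmat n p"
  by (rule eq_matI) (simp_all add: pmat_index string_entry_def cnj_sigma)

lemma pmat_square: "p \<in> paulis n \<Longrightarrow> pmat n p * pmat n p = 1\<^sub>m (2^n)"
  by (auto simp: pmat_mult string_phase_self string_mult_self pmat_id intro!: eq_matI)

lemma unitary_pmat: "p \<in> paulis n \<Longrightarrow> unitary_mat (2^n) (pmat n p)"
  by (simp add: isometry_mat_def mat_adjoint_pmat pmat_square)

lemma sum_string_entry_diag:
  "(\<And>q. q < n \<Longrightarrow> p q < 4) \<Longrightarrow>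
    (\<Sum>i<2^n. string_entry n p i i) = (\<Prod>q<n. if p q = 0 then 2 else 0)"
proof (induction n)
  case 0
  show ?case by (simp add: string_entry_def)
next
  case (Suc n)
  have "(\<Sum>i<2^Suc n. string_entry (Suc n) p i i)
     = (\<Sum>i<2^n. string_entry n p i i) * (sigma (p n) 0 0 + sigma (p n) 1 1)"
    unfolding sum_lessThan_power_Suc distrib_left sum_distrib_right string_entry_Suc string_entry_add_power
    by (intro arg_cong2[where f = "(+)"] sum.cong refl) simp_all
  also have "sigma (p n) 0 0 + sigma (p n) 1 1 = (if p n = 0 then 2 else 0)"
    using Suc.prems[of n] by (auto simp: sigma_def)
  finally show ?case using Suc by simp
qed

lemma mtrace_pmat:
  assumes p: "p \<in> paulis n"
  shows "mtrace (pmat n p) = (if p = pauli_id then 2^n else 0)"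
proof -
  have "p = pauli_id \<longleftrightarrow> (\<forall>q<n. p q = 0)"
    using p by (auto simp: paulis_def pauli_id_def fun_eq_iff) (metis not_le)
  hence "(\<Prod>q<n. if p q = 0 then 2 else 0 :: complex) = (if p = pauli_id then 2^n else 0)" by auto
  moreover have "mtrace (pmat n p) = (\<Sum>i<2^n. string_entry n p i i)"
    by (simp add: mtrace_def pmat_index)
  ultimately show ?thesis using sum_string_entry_diag[of n p] paulis_less[OF p] by simp
qed

lemma string_mult_eq_id_iff:
  assumes "p \<in> paulis n" "q \<in> paulis n"
  shows "string_mult p q = pauli_id \<longleftrightarrow> p = q"
  using pauli_mult_eq_0_iff[OF paulis_less[OF assms(1)] paulis_less[OF assms(2)]]
  by (auto simp: string_mult_def pauli_id_def fun_eq_iff)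

lemma string_mult_eq_right_iff:
  assumes "p \<in> paulis n" "q \<in> paulis n"
  shows "string_mult p q = q \<longleftrightarrow> p = pauli_id"
  using pauli_mult_eq_right_iff[OF paulis_less[OF assms(1)] paulis_less[OF assms(2)]]
  by (auto simp: string_mult_def pauli_id_def fun_eq_iff)

lemma mtrace_pmat_mult:
  assumes p: "p \<in> paulis n" and q: "q \<in> paulis n"
  shows "mtrace (pmat n p * pmat n q) = (if p = q then 2^n else 0)"
  using mtrace_pmat[OF string_mult_paulis[OF p q]]
  by (auto simp: pmat_mult[OF p q] mtrace_smult[OF pmat_carrier] string_mult_eq_id_iff[OF p q]
      string_phase_self)

lemma smult_pmat_eq_iff:
  assumes p: "p \<in> paulis n" and q: "q \<in> paulis n" and "a \<noteq> 0"
  shows "a \<cdot>\<^sub>m pmat n p = b \<cdot>\<^sub>m pmat n q \<longleftrightarrow> p = q \<and> a = b"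
proof
  assume "a \<cdot>\<^sub>m pmat n p = b \<cdot>\<^sub>m pmat n q"
  hence "mtrace (pmat n p * (a \<cdot>\<^sub>m pmat n p)) = mtrace (pmat n p * (b \<cdot>\<^sub>m pmat n q))" by simp
  hence "a * mtrace (pmat n p * pmat n p) = b * mtrace (pmat n p * pmat n q)"
    unfolding mult_smult_distrib[OF pmat_carrier pmat_carrier]
      mtrace_smult[OF mult_carrier_mat[OF pmat_carrier pmat_carrier]] .
  thus "p = q \<and> a = b" using \<open>a \<noteq> 0\<close> by (simp add: mtrace_pmat_mult[OF p] p q split: if_splits)
qed simp

lemma exists_anticommuting_pmat:
  assumes p: "p \<in> paulis n" and "p \<noteq> pauli_id"
  obtains r where "r \<in> paulis n" "anticommutes (pmat n p) (pmat n r)"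
proof -
  obtain j where j: "p j \<noteq> 0" using assms(2) by (auto simp: pauli_id_def)
  hence j_less: "j < n" using p by (metis (mono_tags, lifting) mem_Collect_eq not_le paulis_def)
  define c where "c = (if p j = 1 then 2 else 1 :: nat)"
  define r where "r = (\<lambda>i. if i = j then c else 0)"
  have r: "r \<in> paulis n" using j_less by (auto simp: paulis_def r_def c_def)
  have "string_phase n p r = (\<Prod>i<n. if i = j then pauli_phase (p j) c else 1)"
    unfolding string_phase_def r_def by (intro prod.cong refl) (simp add: pauli_phase_def)
  also have "\<dots> = pauli_phase (p j) c" using j_less by simp
  also have "\<dots> \<in> {\<i>, -\<i>}" using j by (auto simp: c_def pauli_phase_def)
  finally have "string_phase n p r = - string_phase n r p" unfolding string_phase_swap[OF p r] by auto
  hence "anticommutes (pmat n p) (pmat n r)"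
    unfolding anticommutes_def pmat_mult[OF r p] pmat_mult[OF p r] string_mult_commute[of r p]
    by (auto intro!: eq_matI)
  thus ?thesis using that r by blast
qed

section \<open>Exponentials of involutions\<close>

definition involution_exp :: "complex mat \<Rightarrow> complex \<Rightarrow> complex mat" where
  "involution_exp P x = cosh x \<cdot>\<^sub>m 1\<^sub>m (dim_row P) + sinh x \<cdot>\<^sub>m P"

lemma involution_exp_carrier [simp]: "P \<in> carrier_mat N N \<Longrightarrow> involution_exp P x \<in> carrier_mat N N"
  by (simp add: involution_exp_def)

lemma involution_power:
  assumes P: "(P :: complex mat) \<in> carrier_mat N N" "P * P = 1\<^sub>m N"
  shows "P ^\<^sub>m k = (if even k then 1\<^sub>m N else P)"
  using P by (induction k) auto

lemma smult_pow_mat: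
  assumes A: "(A :: 'a :: comm_semiring_1 mat) \<in> carrier_mat N N"
  shows "(c \<cdot>\<^sub>m A) ^\<^sub>m k = c ^ k \<cdot>\<^sub>m A ^\<^sub>m k"
proof (induction k)
  case 0
  show ?case using A by (intro eq_matI) auto
next
  case (Suc k)
  have "(c \<cdot>\<^sub>m A) ^\<^sub>m Suc k = c \<cdot>\<^sub>m (c ^ k \<cdot>\<^sub>m (A ^\<^sub>m k * A))"
    using A by (simp add: Suc mult_smult_assoc_mat[of _ N N] mult_smult_distrib[of _ N N])
  thus ?case by (auto simp: mult.assoc intro!: eq_matI)
qed

lemma mexp_smult_involution:
  assumes P: "P \<in> carrier_mat N N" "P * P = 1\<^sub>m N"
  shows "mexp (c \<cdot>\<^sub>m P) = involution_exp P c"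
proof (rule eq_matI)
  fix i j assume "i < dim_row (involution_exp P c)" "j < dim_col (involution_exp P c)"
  hence ij: "i < N" "j < N" using P by (auto simp: involution_exp_def)
  let ?series = "\<lambda>k. (if even k then c ^ k /\<^sub>R fact k else 0) * 1\<^sub>m N $$ (i, j)
    + (if even k then 0 else c ^ k /\<^sub>R fact k) * P $$ (i, j)"
  have "?series sums (cosh c * 1\<^sub>m N $$ (i, j) + sinh c * P $$ (i, j))"
    by (intro sums_add sums_mult2 cosh_converges sinh_converges)
  also have "?series = (\<lambda>k. ((c \<cdot>\<^sub>m P) ^\<^sub>m k) $$ (i, j) / of_nat (fact k))"
    using ij P
    by (auto simp: smult_pow_mat[OF P(1)] involution_power[OF P] fun_eq_iff scaleR_conv_of_real field_simps)
  finally show "mexp (c \<cdot>\<^sub>m P) $$ (i, j) = involution_exp P c $$ (i, j)"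
    using ij P by (simp add: mexp_def involution_exp_def sums_iff)
qed (use P in \<open>auto simp: mexp_def involution_exp_def\<close>)

lemma involution_exp_mult:
  assumes P: "P \<in> carrier_mat N N" and Q: "Q \<in> carrier_mat N m"
  shows "involution_exp P x * Q = cosh x \<cdot>\<^sub>m Q + sinh x \<cdot>\<^sub>m (P * Q)"
proof -
  have "involution_exp P x * Q = (cosh x \<cdot>\<^sub>m 1\<^sub>m N) * Q + (sinh x \<cdot>\<^sub>m P) * Q"
    unfolding involution_exp_def carrier_matD(1)[OF P]
    by (rule add_mult_distrib_mat[OF smult_carrier_mat[OF one_carrier_mat] smult_carrier_mat[OF P] Q])
  thus ?thesis
    using mult_smult_assoc_mat[OF one_carrier_mat Q] mult_smult_assoc_mat[OF P Q] Q by simp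
qed

lemma mult_involution_exp:
  assumes P: "P \<in> carrier_mat N N" and Q: "Q \<in> carrier_mat m N"
  shows "Q * involution_exp P x = cosh x \<cdot>\<^sub>m Q + sinh x \<cdot>\<^sub>m (Q * P)"
proof -
  have "Q * involution_exp P x = Q * (cosh x \<cdot>\<^sub>m 1\<^sub>m N) + Q * (sinh x \<cdot>\<^sub>m P)"
    unfolding involution_exp_def carrier_matD(1)[OF P]
    by (rule mult_add_distrib_mat[OF Q smult_carrier_mat[OF one_carrier_mat] smult_carrier_mat[OF P]])
  thus ?thesis
    using mult_smult_distrib[OF Q one_carrier_mat] mult_smult_distrib[OF Q P] Q by simp
qed

lemma involution_exp_add:
  assumes P: "P \<in> carrier_mat N N" "P * P = 1\<^sub>m N"
  shows "involution_exp P x * involution_exp P y = involution_exp P (x + y)"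
proof (rule eq_matI)
  fix i j assume "i < dim_row (involution_exp P (x + y))" "j < dim_col (involution_exp P (x + y))"
  hence "i < N" "j < N" using P(1) by (auto simp: involution_exp_def)
  thus "(involution_exp P x * involution_exp P y) $$ (i, j) = involution_exp P (x + y) $$ (i, j)"
    unfolding involution_exp_mult[OF P(1) involution_exp_carrier[OF P(1)]]
      mult_involution_exp[OF P(1) P(1)] P(2)
    using P(1) by (simp add: involution_exp_def cosh_add sinh_add distrib_left distrib_right)
qed (use P in \<open>auto simp: involution_exp_def\<close>)

lemma involution_exp_0: "P \<in> carrier_mat N N \<Longrightarrow> involution_exp P 0 = 1\<^sub>m N"
  by (rule eq_matI) (auto simp: involution_exp_def)

lemma cosh_complex_of_real: "cosh (complex_of_real x) = complex_of_real (cosh x)"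
  and sinh_complex_of_real: "sinh (complex_of_real x) = complex_of_real (sinh x)"
  using exp_of_real[of x, where 'a = complex] exp_of_real[of "-x", where 'a = complex]
  by (simp_all add: cosh_def sinh_def scaleR_conv_of_real)

lemma mat_adjoint_involution_exp:
  assumes P: "P \<in> carrier_mat N N" "mat_adjoint P = P"
  shows "mat_adjoint (involution_exp P (complex_of_real x)) = involution_exp P (complex_of_real x)"
  using P(1) unfolding involution_exp_def
  by (subst mat_adjoint_add[of _ N N])
    (auto simp: mat_adjoint_smult P(2) cosh_complex_of_real sinh_complex_of_real)

lemma involution_exp_conjugate_commuting:
  assumes P: "P \<in> carrier_mat N N" "P * P = 1\<^sub>m N" and Q: "Q \<in> carrier_mat N N" and "commutes P Q"
  shows "involution_exp P x * Q * involution_exp P x = cosh (2 * x) \<cdot>\<^sub>m Q + sinh (2 * x) \<cdot>\<^sub>m (P * Q)"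
proof -
  let ?E = "involution_exp P"
  have E: "?E x \<in> carrier_mat N N" using P by simp
  have "Q * ?E x = ?E x * Q"
    using \<open>commutes P Q\<close>
    unfolding mult_involution_exp[OF P(1) Q] involution_exp_mult[OF P(1) Q] commutes_def by simp
  hence "?E x * Q * ?E x = ?E x * ?E x * Q"
    by (simp add: assoc_mult_mat[OF E Q E] assoc_mult_mat[OF E E Q])
  also have "\<dots> = ?E (2 * x) * Q" by (simp add: involution_exp_add[OF P])
  finally show ?thesis by (simp add: involution_exp_mult[OF P(1) Q])
qed

lemma involution_exp_conjugate_anticommuting:
  assumes P: "P \<in> carrier_mat N N" "P * P = 1\<^sub>m N" and Q: "Q \<in> carrier_mat N N" and "anticommutes P Q"
  shows "involution_exp P x * Q * involution_exp P x = Q"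
proof -
  let ?E = "involution_exp P"
  have E: "?E x \<in> carrier_mat N N" for x using P by simp
  have "Q * ?E x = ?E (- x) * Q"
    using \<open>anticommutes P Q\<close> P Q
    unfolding mult_involution_exp[OF P(1) Q] involution_exp_mult[OF P(1) Q] anticommutes_def
    by (intro eq_matI) (auto simp del: index_mult_mat(1))
  hence "?E x * Q * ?E x = ?E x * ?E (- x) * Q"
    by (simp add: assoc_mult_mat[OF E Q E] assoc_mult_mat[OF E E Q])
  thus ?thesis using Q by (simp add: involution_exp_add[OF P] involution_exp_0[OF P(1)])
qed

lemma det_involution_exp_square:
  assumes P: "P \<in> carrier_mat N N" "P * P = 1\<^sub>m N"
    and R: "R \<in> carrier_mat N N" "anticommutes P R" "det R \<noteq> 0"
  shows "det (involution_exp P x) * det (involution_exp P x) = 1"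
proof -
  let ?E = "involution_exp P x"
  have E: "?E \<in> carrier_mat N N" using P by simp
  have "det (?E * R * ?E) = det R"
    by (simp add: involution_exp_conjugate_anticommuting[OF P R(1,2)])
  hence "(det ?E * det ?E) * det R = det R"
    by (simp add: det_mult[OF mult_carrier_mat[OF E R(1)] E] det_mult[OF E R(1)] ac_simps)
  thus ?thesis using R(3) by simp
qed

section \<open>Imaginary-time evolution under signed Pauli strings\<close>

definition signed_pauli :: "nat \<Rightarrow> complex mat \<Rightarrow> bool" where
  "signed_pauli n P \<longleftrightarrow>
     (\<exists>\<sigma> p. (\<sigma> = 1 \<or> \<sigma> = - 1) \<and> p \<in> paulis n \<and> p \<noteq> pauli_id \<and> P = complex_of_real \<sigma> \<cdot>\<^sub>m pmat n p)"

lemma signed_pauliE: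
  assumes "signed_pauli n P"
  obtains \<sigma> p where "\<sigma> = 1 \<or> \<sigma> = - 1" "p \<in> paulis n" "p \<noteq> pauli_id" "P = complex_of_real \<sigma> \<cdot>\<^sub>m pmat n p"
  using assms by (auto simp: signed_pauli_def)

lemma signed_pauli_gen_mat:
  "sg t = 1 \<or> sg t = - 1 \<Longrightarrow> G t \<in> paulis n \<Longrightarrow> G t \<noteq> pauli_id \<Longrightarrow> signed_pauli n (gen_mat n sg G t)"
  unfolding signed_pauli_def gen_mat_def by blast

lemma signed_pauli_carrier: "signed_pauli n P \<Longrightarrow> P \<in> carrier_mat (2^n) (2^n)"
  by (auto simp: signed_pauli_def)

lemma signed_pauli_square:
  assumes "signed_pauli n P"
  shows "P * P = 1\<^sub>m (2^n)"
proof -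
  obtain \<sigma> p where \<sigma>: "\<sigma> = 1 \<or> \<sigma> = (- 1 :: real)" and p: "p \<in> paulis n"
    and P: "P = complex_of_real \<sigma> \<cdot>\<^sub>m pmat n p"
    using assms by (rule signed_pauliE)
  have "P * P = complex_of_real \<sigma> \<cdot>\<^sub>m (complex_of_real \<sigma> \<cdot>\<^sub>m 1\<^sub>m (2^n))"
    unfolding P mult_smult_assoc_mat[OF pmat_carrier smult_carrier_mat[OF pmat_carrier]]
      mult_smult_distrib[OF pmat_carrier pmat_carrier] pmat_square[OF p] ..
  thus ?thesis using \<sigma> by (auto intro!: eq_matI)
qed

lemma mat_adjoint_signed_pauli: "signed_pauli n P \<Longrightarrow> mat_adjoint P = P"
  by (auto simp: signed_pauli_def mat_adjoint_smult mat_adjoint_pmat)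

lemma exists_anticommuting_invertible_mat:
  assumes "signed_pauli n P"
  obtains R where "R \<in> carrier_mat (2^n) (2^n)" "anticommutes P R" "det R \<noteq> 0"
proof -
  obtain \<sigma> p where p: "p \<in> paulis n" "p \<noteq> pauli_id" and P: "P = complex_of_real \<sigma> \<cdot>\<^sub>m pmat n p"
    using assms by (rule signed_pauliE)
  obtain r where r: "r \<in> paulis n" and anti: "anticommutes (pmat n p) (pmat n r)"
    by (rule exists_anticommuting_pmat[OF p])
  have "anticommutes P (pmat n r)"
    using anti unfolding anticommutes_def P mult_smult_distrib[OF pmat_carrier pmat_carrier]
      mult_smult_assoc_mat[OF pmat_carrier pmat_carrier]
    by (auto simp del: index_mult_mat(1) intro!: eq_matI)
  moreover have "det (pmat n r) * det (pmat n r) = 1"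
    using det_mult[OF pmat_carrier pmat_carrier, of n r r] by (simp add: pmat_square[OF r])
  hence "det (pmat n r) \<noteq> 0" by auto
  ultimately show thesis using that pmat_carrier by blast
qed

lemma chan_eq_involution_exp:
  assumes "signed_pauli n (gen_mat n sg G t)"
  shows "chan n \<tau> sg G t X = involution_exp (gen_mat n sg G t) (complex_of_real (- \<tau> / 2)) * X
    * involution_exp (gen_mat n sg G t) (complex_of_real (- \<tau> / 2))"
  unfolding chan_def
    mexp_smult_involution[OF signed_pauli_carrier[OF assms] signed_pauli_square[OF assms]] ..

lemma Aop_eq_mult_adjoint:
  assumes "\<forall>t\<in>{1..L}. signed_pauli n (gen_mat n sg G t)"
  shows "\<exists>V\<in>carrier_mat (2^n) (2^n). Aop n \<tau> sg G L = V * mat_adjoint V \<and> det (V * mat_adjoint V) = 1"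
  using assms
proof (induction L)
  case 0
  show ?case by (intro bexI[of _ "1\<^sub>m (2^n)"]) auto
next
  case (Suc L)
  then obtain V where V: "V \<in> carrier_mat (2^n) (2^n)" and A: "Aop n \<tau> sg G L = V * mat_adjoint V"
    and det: "det (V * mat_adjoint V) = 1" by auto
  define P where "P = gen_mat n sg G (Suc L)"
  have P: "signed_pauli n P" using Suc.prems by (simp add: P_def)
  note involution = signed_pauli_carrier[OF P] signed_pauli_square[OF P]
  define B where "B = involution_exp P (complex_of_real (- \<tau> / 2))"
  have B: "B \<in> carrier_mat (2^n) (2^n)" using involution by (simp add: B_def)
  have hermitian_B: "mat_adjoint B = B"
    unfolding B_def by (rule mat_adjoint_involution_exp[OF involution(1) mat_adjoint_signed_pauli[OF P]])
  have V': "mat_adjoint V \<in> carrier_mat (2^n) (2^n)" and BV: "B * V \<in> carrier_mat (2^n) (2^n)"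
    and VV: "V * mat_adjoint V \<in> carrier_mat (2^n) (2^n)" using V B by auto
  have "Aop n \<tau> sg G (Suc L) = B * (V * mat_adjoint V) * B"
    using chan_eq_involution_exp P unfolding P_def B_def by (simp add: A)
  also have regroup: "\<dots> = (B * V) * mat_adjoint (B * V)"
    unfolding mat_adjoint_mult[OF B V] hermitian_B
    using assoc_mult_mat[OF B V V'] assoc_mult_mat[OF BV V' B] by simp
  finally have gram: "Aop n \<tau> sg G (Suc L) = (B * V) * mat_adjoint (B * V)" .
  obtain R where "R \<in> carrier_mat (2^n) (2^n)" "anticommutes P R" "det R \<noteq> 0"
    by (rule exists_anticommuting_invertible_mat[OF P])
  hence "det B * det B = 1" unfolding B_def by (rule det_involution_exp_square[OF involution])
  hence "det ((B * V) * mat_adjoint (B * V)) = 1"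
    unfolding regroup[symmetric] det_mult[OF mult_carrier_mat[OF B VV] B] det_mult[OF B VV] det by simp
  thus ?case using BV gram by blast
qed

section \<open>Pauli paths\<close>

definition valid_step :: "nat \<Rightarrow> complex mat \<Rightarrow> (nat \<Rightarrow> nat) \<Rightarrow> (nat \<Rightarrow> nat) \<Rightarrow> bool" where
  "valid_step n P q r \<longleftrightarrow> (let a = step_a n P q r; b = step_b n P q r; c = step_c n P q r
     in (a \<and> \<not> b \<and> \<not> c) \<or> (\<not> a \<and> b \<and> \<not> c) \<or> (\<not> a \<and> \<not> b \<and> c))"

definition successors :: "nat \<Rightarrow> complex mat \<Rightarrow> (nat \<Rightarrow> nat) \<Rightarrow> (nat \<Rightarrow> nat) set" where
  "successors n P q = {r \<in> paulis n. valid_step n P q r}"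

lemma smult_smult_mat: "a \<cdot>\<^sub>m (b \<cdot>\<^sub>m X) = (a * b) \<cdot>\<^sub>m (X :: 'a :: semigroup_mult mat)"
  by (rule eq_matI) (auto simp: mult.assoc)

lemma uminus_smult_mat: "- (a \<cdot>\<^sub>m X) = (- a) \<cdot>\<^sub>m (X :: 'a :: ring mat)"
  by (rule eq_matI) auto

lemma signed_pauli_mult_pmat_cases:
  assumes "signed_pauli n P" and q: "q \<in> paulis n"
  obtains (anti) "anticommutes P (pmat n q)" "\<not> commutes P (pmat n q)"
  | (comm) \<sigma> r where "commutes P (pmat n q)" "\<not> anticommutes P (pmat n q)" "\<sigma> = 1 \<or> \<sigma> = - 1"
      "r \<in> paulis n" "r \<noteq> q" "P * pmat n q = complex_of_real \<sigma> \<cdot>\<^sub>m pmat n r"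
proof -
  obtain s p where s: "s = 1 \<or> s = (- 1 :: real)" and p: "p \<in> paulis n" "p \<noteq> pauli_id"
    and P: "P = complex_of_real s \<cdot>\<^sub>m pmat n p"
    using assms(1) by (rule signed_pauliE)
  define z where "z = string_phase n p q"
  define r where "r = string_mult p q"
  have r: "r \<in> paulis n" unfolding r_def by (rule string_mult_paulis[OF p(1) q])
  have Pq: "P * pmat n q = (complex_of_real s * z) \<cdot>\<^sub>m pmat n r"
    unfolding P mult_smult_assoc_mat[OF pmat_carrier pmat_carrier] pmat_mult[OF p(1) q] smult_smult_mat
      r_def z_def ..
  have qP: "pmat n q * P = (complex_of_real s * cnj z) \<cdot>\<^sub>m pmat n r"
    unfolding P mult_smult_distrib[OF pmat_carrier pmat_carrier] pmat_mult[OF q p(1)] smult_smult_mat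
      r_def z_def string_mult_commute[of q] string_phase_swap[OF p(1) q] ..
  have phase: "z \<in> {1, - 1, \<i>, - \<i>}" unfolding z_def by (rule string_phase_cases)
  hence nonzero: "complex_of_real s * z \<noteq> 0" using s by auto
  have comm_iff: "commutes P (pmat n q) \<longleftrightarrow> z = cnj z"
    unfolding commutes_def Pq qP smult_pmat_eq_iff[OF r r nonzero] using s by auto
  have anti_iff: "anticommutes P (pmat n q) \<longleftrightarrow> z = - cnj z"
    unfolding anticommutes_def Pq qP uminus_smult_mat smult_pmat_eq_iff[OF r r nonzero]
    using s by auto (metis minus_minus)
  consider (imaginary) "z \<in> {\<i>, - \<i>}" | (real) "z \<in> {1, - 1}" using phase by auto
  thus thesis
  proof cases
    case imaginary
    thus thesis by (intro anti) (auto simp: comm_iff anti_iff)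
  next
    case real
    have "r \<noteq> q" using string_mult_eq_right_iff[OF p(1) q] p(2) by (simp add: r_def)
    moreover have "complex_of_real s * z = complex_of_real (s * Re z)" using real by auto
    ultimately show thesis using real s r Pq by (intro comm[of "s * Re z" r]) (auto simp: comm_iff anti_iff)
  qed
qed

lemma step_c_iff:
  assumes "commutes P (pmat n q)" "\<sigma> = 1 \<or> \<sigma> = - 1" "P * pmat n q = complex_of_real \<sigma> \<cdot>\<^sub>m pmat n r"
    and "r \<in> paulis n" "x \<in> paulis n"
  shows "step_c n P q x \<longleftrightarrow> x = r"
  using assms smult_pmat_eq_iff[OF assms(4,5), of "complex_of_real \<sigma>"] unfolding step_c_def by auto

lemma step_sign_eq:
  assumes \<sigma>: "\<sigma> = 1 \<or> \<sigma> = - 1" and Pq: "P * pmat n q = complex_of_real \<sigma> \<cdot>\<^sub>m pmat n r" and r: "r \<in> paulis n"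
  shows "step_sign n P q r = \<sigma>"
  unfolding step_sign_def
proof (rule the_equality)
  fix s :: real assume "(s = 1 \<or> s = - 1) \<and> P * pmat n q = complex_of_real s \<cdot>\<^sub>m pmat n r"
  thus "s = \<sigma>"
    using smult_pmat_eq_iff[OF r r, of "complex_of_real \<sigma>" "complex_of_real s"] \<sigma> by (auto simp: Pq)
qed (use \<sigma> Pq in simp)

lemma pauli_step_cases:
  assumes P: "signed_pauli n P" and q: "q \<in> paulis n"
  obtains (anti) "anticommutes P (pmat n q)" "successors n P q = {q}"
      "step_factor n \<tau> P q q = 1" "\<not> step_c n P q q"
  | (comm) \<sigma> r where "commutes P (pmat n q)" "\<sigma> = 1 \<or> \<sigma> = - 1" "r \<noteq> q"
      "P * pmat n q = complex_of_real \<sigma> \<cdot>\<^sub>m pmat n r" "successors n P q = {q, r}"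
      "step_factor n \<tau> P q q = cosh \<tau>" "step_factor n \<tau> P q r = - \<sigma> * sinh \<tau>"
      "\<not> step_c n P q q" "step_c n P q r"
  using P q
proof (cases rule: signed_pauli_mult_pmat_cases)
  case anti
  hence "successors n P q = {q}"
    using q by (auto simp: successors_def valid_step_def step_a_def step_b_def step_c_def)
  thus ?thesis
    using anti by (intro that(1)) (auto simp: step_factor_def step_a_def step_c_def)
next
  case (comm \<sigma> r)
  have step_c: "step_c n P q x \<longleftrightarrow> x = r" if "x \<in> paulis n" for x
    by (rule step_c_iff[OF comm(1,3,6,4) that])
  have step_a_b: "\<not> step_a n P q x" "step_b n P q x \<longleftrightarrow> x = q" for x
    using comm(1,2) by (auto simp: step_a_def step_b_def)
  have "successors n P q = {q, r}"
    using q comm(4,5) by (auto simp: successors_def valid_step_def step_a_b step_c)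
  thus ?thesis
    using comm q step_sign_eq[OF comm(3,6,4)]
    by (intro that(2)[of \<sigma> r]) (auto simp: step_factor_def step_a_b step_c)
qed

lemma finite_paulis: "finite (paulis n)"
proof -
  have "paulis n = {f. \<forall>x. (x \<in> {..<n} \<longrightarrow> f x \<in> {..<4}) \<and> (x \<notin> {..<n} \<longrightarrow> f x = 0)}"
    by (simp add: paulis_def all_conj_distrib not_less)
  thus ?thesis using finite_set_of_finite_funs[of "{..<n}" "{..<4::nat}" 0] by simp
qed

lemma finite_pauli_paths: "finite {\<gamma>. pauli_path n s G L \<gamma>}"
  by (rule finite_subset[OF _ finite_lists_length_eq[OF finite_paulis, of n "L + 1"]])
    (auto simp: pauli_path_def)

lemma pauli_path_length: "pauli_path n s G L \<gamma> \<Longrightarrow> length \<gamma> = Suc L"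
  by (simp add: pauli_path_def)

lemma pauli_path_nth: "pauli_path n s G L \<gamma> \<Longrightarrow> t \<le> L \<Longrightarrow> \<gamma> ! t \<in> paulis n"
  by (auto simp: pauli_path_def subset_eq)

lemma pauli_paths_0: "{\<gamma>. pauli_path n s G 0 \<gamma>} = {[pauli_id]}"
  by (auto simp: pauli_path_def length_Suc_conv paulis_def pauli_id_def)

lemma pauli_path_iff_valid_step:
  "pauli_path n s G L \<gamma> \<longleftrightarrow> length \<gamma> = L + 1 \<and> set \<gamma> \<subseteq> paulis n \<and> \<gamma> ! 0 = pauli_id \<and>
     (\<forall>t\<in>{1..L}. valid_step n (gen_mat n s G t) (\<gamma> ! (t - 1)) (\<gamma> ! t))"
  by (simp add: pauli_path_def valid_step_def Let_def)

lemma pauli_path_snoc: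
  assumes len: "length \<gamma> = Suc L"
  shows "pauli_path n s G (Suc L) (\<gamma> @ [r]) \<longleftrightarrow>
    pauli_path n s G L \<gamma> \<and> r \<in> successors n (gen_mat n s G (Suc L)) (\<gamma> ! L)"
proof -
  have "(\<forall>t\<in>{1..Suc L}. valid_step n (gen_mat n s G t) ((\<gamma> @ [r]) ! (t - 1)) ((\<gamma> @ [r]) ! t))
    \<longleftrightarrow> (\<forall>t\<in>{1..L}. valid_step n (gen_mat n s G t) (\<gamma> ! (t - 1)) (\<gamma> ! t))
      \<and> valid_step n (gen_mat n s G (Suc L)) (\<gamma> ! L) r"
    using len by (auto simp: atLeastAtMostSuc_conv nth_append)
  thus ?thesis
    unfolding pauli_path_iff_valid_step using len by (auto simp: successors_def nth_append)
qed

lemma pauli_paths_Suc: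
  "{\<gamma>. pauli_path n s G (Suc L) \<gamma>} = (\<lambda>(\<gamma>, r). \<gamma> @ [r]) `
     (SIGMA \<gamma>:{\<gamma>. pauli_path n s G L \<gamma>}. successors n (gen_mat n s G (Suc L)) (\<gamma> ! L))"
    (is "_ = _ ` ?S")
proof (intro equalityI subsetI)
  fix \<delta> assume "\<delta> \<in> {\<gamma>. pauli_path n s G (Suc L) \<gamma>}"
  hence \<delta>: "pauli_path n s G (Suc L) \<delta>" by simp
  hence "\<delta> = butlast \<delta> @ [last \<delta>]" "length (butlast \<delta>) = Suc L"
    using pauli_path_length[OF \<delta>] by (auto simp: append_butlast_last_id simp flip: length_greater_0_conv)
  thus "\<delta> \<in> (\<lambda>(\<gamma>, r). \<gamma> @ [r]) ` ?S"
    using \<delta> pauli_path_snoc[of "butlast \<delta>" L n s G "last \<delta>"]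
    by (intro image_eqI[of _ _ "(butlast \<delta>, last \<delta>)"]) auto
next
  fix \<delta> assume "\<delta> \<in> (\<lambda>(\<gamma>, r). \<gamma> @ [r]) ` ?S"
  thus "\<delta> \<in> {\<gamma>. pauli_path n s G (Suc L) \<gamma>}"
    using pauli_path_snoc pauli_path_length by fastforce
qed

lemma sum_pauli_paths_Suc:
  fixes f :: "(nat \<Rightarrow> nat) list \<Rightarrow> 'a :: comm_monoid_add"
  shows "(\<Sum>\<gamma> | pauli_path n s G (Suc L) \<gamma>. f \<gamma>)
    = (\<Sum>\<gamma> | pauli_path n s G L \<gamma>. \<Sum>r\<in>successors n (gen_mat n s G (Suc L)) (\<gamma> ! L). f (\<gamma> @ [r]))"
proof -
  let ?S = "SIGMA \<gamma>:{\<gamma>. pauli_path n s G L \<gamma>}. successors n (gen_mat n s G (Suc L)) (\<gamma> ! L)"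
  have "(\<Sum>\<gamma> | pauli_path n s G (Suc L) \<gamma>. f \<gamma>) = (\<Sum>(\<gamma>, r)\<in>?S. f (\<gamma> @ [r]))"
    unfolding pauli_paths_Suc by (subst sum.reindex) (auto simp: inj_on_def case_prod_unfold)
  also have "\<dots> = (\<Sum>\<gamma> | pauli_path n s G L \<gamma>. \<Sum>r\<in>successors n (gen_mat n s G (Suc L)) (\<gamma> ! L). f (\<gamma> @ [r]))"
    by (rule sum.Sigma[symmetric]) (auto simp: finite_pauli_paths successors_def finite_paulis)
  finally show ?thesis .
qed

lemma path_coef_snoc:
  assumes "length \<gamma> = Suc L"
  shows "path_coef n \<tau> s G (Suc L) (\<gamma> @ [r])
    = path_coef n \<tau> s G L \<gamma> * step_factor n \<tau> (gen_mat n s G (Suc L)) (\<gamma> ! L) r"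
proof -
  have "(\<Prod>t\<in>{1..L}. step_factor n \<tau> (gen_mat n s G t) ((\<gamma> @ [r]) ! (t - 1)) ((\<gamma> @ [r]) ! t))
    = path_coef n \<tau> s G L \<gamma>"
    unfolding path_coef_def using assms by (intro prod.cong refl) (auto simp: nth_append)
  thus ?thesis using assms by (simp add: path_coef_def nth_append)
qed

lemma path_r_snoc:
  assumes "length \<gamma> = Suc L"
  shows "path_r n s G (Suc L) (\<gamma> @ [r])
    = path_r n s G L \<gamma> + of_bool (step_c n (gen_mat n s G (Suc L)) (\<gamma> ! L) r)"
proof -
  let ?T = "{t\<in>{1..L}. step_c n (gen_mat n s G t) (\<gamma> ! (t - 1)) (\<gamma> ! t)}"
  have updates: "{t\<in>{1..Suc L}. step_c n (gen_mat n s G t) ((\<gamma> @ [r]) ! (t - 1)) ((\<gamma> @ [r]) ! t)}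
    = ?T \<union> (if step_c n (gen_mat n s G (Suc L)) (\<gamma> ! L) r then {Suc L} else {})"
    using assms by (auto simp: nth_append le_Suc_eq)
  show ?thesis unfolding path_r_def updates by (subst card_Un_disjoint) auto
qed

section \<open>The path expansion\<close>

definition path_term ::
  "nat \<Rightarrow> real \<Rightarrow> (nat \<Rightarrow> real) \<Rightarrow> (nat \<Rightarrow> nat \<Rightarrow> nat) \<Rightarrow> nat \<Rightarrow> (nat \<Rightarrow> nat) list \<Rightarrow> complex mat" where
  "path_term n \<tau> s G L \<gamma> = complex_of_real (path_coef n \<tau> s G L \<gamma>) \<cdot>\<^sub>m pmat n (\<gamma> ! L)"

lemma path_term_carrier [simp]: "path_term n \<tau> s G L \<gamma> \<in> carrier_mat (2^n) (2^n)"
  by (simp add: path_term_def)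

lemma Atrunc_path_expansion:
  "Atrunc n \<tau> s G L k
    = mat_sum (2^n) (path_term n \<tau> s G L) {\<gamma>. pauli_path n s G L \<gamma> \<and> path_r n s G L \<gamma> \<le> k}"
  by (rule eq_matI) (auto simp: Atrunc_def mat_sum_def path_term_def)

lemma evolved_pmat_eq_sum_successors:
  fixes \<tau> :: real
  assumes P: "signed_pauli n P" and q: "q \<in> paulis n"
  defines "B \<equiv> involution_exp P (complex_of_real (- \<tau> / 2))"
  shows "B * pmat n q * B
    = mat_sum (2^n) (\<lambda>r. complex_of_real (step_factor n \<tau> P q r) \<cdot>\<^sub>m pmat n r) (successors n P q)"
  using P q
proof (cases rule: pauli_step_cases[where \<tau> = \<tau>, case_names anti comm])
  case anti
  have "B * pmat n q * B = pmat n q"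
    unfolding B_def
    by (rule involution_exp_conjugate_anticommuting[OF signed_pauli_carrier[OF P] signed_pauli_square[OF P]
        pmat_carrier anti(1)])
  thus ?thesis by (auto simp: anti mat_sum_def intro!: eq_matI)
next
  case (comm \<sigma> r)
  have "B * pmat n q * B
    = complex_of_real (cosh \<tau>) \<cdot>\<^sub>m pmat n q + complex_of_real (- sinh \<tau>) \<cdot>\<^sub>m (P * pmat n q)"
    using involution_exp_conjugate_commuting[OF signed_pauli_carrier[OF P] signed_pauli_square[OF P]
        pmat_carrier comm(1)]
    by (simp add: B_def cosh_complex_of_real sinh_complex_of_real)
  thus ?thesis using comm by (auto simp: comm(4) mat_sum_def algebra_simps intro!: eq_matI)
qed

lemma evolved_path_term_eq_sum_successors:
  fixes n L :: nat and \<tau> :: real and s :: "nat \<Rightarrow> real" and G :: "nat \<Rightarrow> nat \<Rightarrow> nat"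
  defines "B \<equiv> involution_exp (gen_mat n s G (Suc L)) (complex_of_real (- \<tau> / 2))"
  assumes P: "signed_pauli n (gen_mat n s G (Suc L))" and path: "pauli_path n s G L \<gamma>"
  shows "B * path_term n \<tau> s G L \<gamma> * B
    = mat_sum (2^n) (\<lambda>r. path_term n \<tau> s G (Suc L) (\<gamma> @ [r])) (successors n (gen_mat n s G (Suc L)) (\<gamma> ! L))"
proof -
  let ?P = "gen_mat n s G (Suc L)" and ?q = "\<gamma> ! L" and ?c = "complex_of_real (path_coef n \<tau> s G L \<gamma>)"
  have B: "B \<in> carrier_mat (2^n) (2^n)" using signed_pauli_carrier[OF P] by (simp add: B_def)
  have "B * path_term n \<tau> s G L \<gamma> * B = ?c \<cdot>\<^sub>m (B * pmat n ?q * B)"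
    unfolding path_term_def mult_smult_distrib[OF B pmat_carrier]
    by (rule mult_smult_assoc_mat[OF mult_carrier_mat[OF B pmat_carrier] B])
  also have "\<dots> = ?c \<cdot>\<^sub>m
      mat_sum (2^n) (\<lambda>r. complex_of_real (step_factor n \<tau> ?P ?q r) \<cdot>\<^sub>m pmat n r) (successors n ?P ?q)"
    unfolding B_def evolved_pmat_eq_sum_successors[OF P pauli_path_nth[OF path order_refl]] ..
  also have "\<dots> = mat_sum (2^n) (\<lambda>r. path_term n \<tau> s G (Suc L) (\<gamma> @ [r])) (successors n ?P ?q)"
    using pauli_path_length[OF path] unfolding smult_mat_sum[OF smult_carrier_mat[OF pmat_carrier]]
    by (simp add: path_term_def path_coef_snoc smult_smult_mat nth_append)
  finally show ?thesis .
qed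

lemma Aop_path_expansion:
  assumes "\<forall>t\<in>{1..L}. signed_pauli n (gen_mat n s G t)"
  shows "Aop n \<tau> s G L = mat_sum (2^n) (path_term n \<tau> s G L) {\<gamma>. pauli_path n s G L \<gamma>}"
  using assms
proof (induction L)
  case 0
  show ?case by (rule eq_matI) (auto simp: pauli_paths_0 path_term_def path_coef_def pmat_id mat_sum_def)
next
  case (Suc L)
  let ?S = "{\<gamma>. pauli_path n s G L \<gamma>}" and ?P = "gen_mat n s G (Suc L)"
  let ?B = "involution_exp ?P (complex_of_real (- \<tau> / 2))"
  have P: "signed_pauli n ?P" using Suc.prems by simp
  have B: "?B \<in> carrier_mat (2^n) (2^n)" using signed_pauli_carrier[OF P] by simp
  have "Aop n \<tau> s G (Suc L) = ?B * mat_sum (2^n) (path_term n \<tau> s G L) ?S * ?B"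
    using Suc by (simp add: chan_eq_involution_exp[OF P])
  also have "\<dots> = mat_sum (2^n) (\<lambda>\<gamma>. ?B * path_term n \<tau> s G L \<gamma> * ?B) ?S"
    unfolding mult_mat_sum[OF B path_term_carrier]
    by (rule mat_sum_mult[OF B mult_carrier_mat[OF B path_term_carrier]])
  also have "\<dots> = mat_sum (2^n)
      (\<lambda>\<gamma>. mat_sum (2^n) (\<lambda>r. path_term n \<tau> s G (Suc L) (\<gamma> @ [r])) (successors n ?P (\<gamma> ! L))) ?S"
    by (intro mat_sum_cong evolved_path_term_eq_sum_successors[OF P]) simp
  also have "\<dots> = mat_sum (2^n) (path_term n \<tau> s G (Suc L)) {\<gamma>. pauli_path n s G (Suc L) \<gamma>}"
    by (rule eq_matI) (auto simp: mat_sum_def sum_pauli_paths_Suc)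
  finally show ?case .
qed

section \<open>The weight of paths with many non-identity updates\<close>

lemma sum_successors_weight_le:
  assumes P: "signed_pauli n P" and q: "q \<in> paulis n" and "\<tau> \<ge> 0" "w \<ge> 0"
  shows "(\<Sum>r\<in>successors n P q. \<bar>step_factor n \<tau> P q r\<bar> * w ^ of_bool (step_c n P q r))
    \<le> cosh \<tau> + w * sinh \<tau>"
  using P q
proof (cases rule: pauli_step_cases[where \<tau> = \<tau>, case_names anti comm])
  case anti
  have "0 \<le> w * sinh \<tau>" using assms by simp
  moreover have "1 \<le> cosh \<tau>" by (rule cosh_real_ge_1)
  ultimately show ?thesis using anti by simp
next
  case (comm \<sigma> r)
  have "\<bar>\<sigma>\<bar> = 1" using comm(2) by auto
  thus ?thesis using comm \<open>\<tau> \<ge> 0\<close> by (simp add: abs_mult)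
qed

lemma path_weight_sum_le:
  assumes "\<forall>t\<in>{1..L}. signed_pauli n (gen_mat n s G t)" and \<tau>: "\<tau> \<ge> 0" and w: "w \<ge> 0"
  shows "(\<Sum>\<gamma> | pauli_path n s G L \<gamma>. \<bar>path_coef n \<tau> s G L \<gamma>\<bar> * w ^ path_r n s G L \<gamma>)
    \<le> (cosh \<tau> + w * sinh \<tau>) ^ L"
  using assms(1)
proof (induction L)
  case 0
  show ?case by (simp add: pauli_paths_0 path_coef_def path_r_def)
next
  case (Suc L)
  let ?P = "gen_mat n s G (Suc L)" and ?S = "{\<gamma>. pauli_path n s G L \<gamma>}"
  let ?weight = "\<lambda>\<gamma>. \<bar>path_coef n \<tau> s G L \<gamma>\<bar> * w ^ path_r n s G L \<gamma>"
  have P: "signed_pauli n ?P" using Suc.prems by simp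
  have "(\<Sum>\<gamma> | pauli_path n s G (Suc L) \<gamma>. \<bar>path_coef n \<tau> s G (Suc L) \<gamma>\<bar> * w ^ path_r n s G (Suc L) \<gamma>)
    = (\<Sum>\<gamma>\<in>?S. ?weight \<gamma> * (\<Sum>r\<in>successors n ?P (\<gamma> ! L).
        \<bar>step_factor n \<tau> ?P (\<gamma> ! L) r\<bar> * w ^ of_bool (step_c n ?P (\<gamma> ! L) r)))"
    unfolding sum_pauli_paths_Suc sum_distrib_left
  proof (intro sum.cong refl)
    fix \<gamma> r assume "\<gamma> \<in> ?S"
    hence len: "length \<gamma> = Suc L" by (simp add: pauli_path_length)
    show "\<bar>path_coef n \<tau> s G (Suc L) (\<gamma> @ [r])\<bar> * w ^ path_r n s G (Suc L) (\<gamma> @ [r])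
      = ?weight \<gamma> * (\<bar>step_factor n \<tau> ?P (\<gamma> ! L) r\<bar> * w ^ of_bool (step_c n ?P (\<gamma> ! L) r))"
      unfolding path_coef_snoc[OF len] path_r_snoc[OF len] abs_mult power_add by simp
  qed
  also have "\<dots> \<le> (\<Sum>\<gamma>\<in>?S. ?weight \<gamma> * (cosh \<tau> + w * sinh \<tau>))"
    using w
    by (intro sum_mono mult_left_mono sum_successors_weight_le[OF P _ \<tau> w]) (auto intro: pauli_path_nth)
  also have "\<dots> = (\<Sum>\<gamma>\<in>?S. ?weight \<gamma>) * (cosh \<tau> + w * sinh \<tau>)" by (simp add: sum_distrib_right)
  also have "\<dots> \<le> (cosh \<tau> + w * sinh \<tau>) ^ L * (cosh \<tau> + w * sinh \<tau>)"
    using Suc \<tau> w by (intro mult_right_mono add_nonneg_nonneg mult_nonneg_nonneg) auto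
  finally show ?case by (simp add: mult.commute)
qed

lemma cosh_plus_sinh_le_exp:
  fixes \<tau> w :: real
  assumes "w \<ge> 1"
  shows "cosh \<tau> + w * sinh \<tau> \<le> exp (w * \<tau>)"
proof -
  have "cosh \<tau> + w * sinh \<tau> = exp \<tau> * (1 + (w - 1) * ((1 - exp (- 2 * \<tau>)) / 2))"
    by (simp add: cosh_def sinh_def field_simps flip: exp_add)
  also have "\<dots> \<le> exp \<tau> * (1 + (w - 1) * \<tau>)"
    using assms exp_ge_add_one_self[of "- 2 * \<tau>"] by (intro mult_left_mono add_left_mono) auto
  also have "\<dots> \<le> exp \<tau> * exp ((w - 1) * \<tau>)" by (intro mult_left_mono exp_ge_add_one_self) auto
  finally show ?thesis by (simp add: algebra_simps flip: exp_add)
qed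

definition path_tail :: "nat \<Rightarrow> real \<Rightarrow> (nat \<Rightarrow> real) \<Rightarrow> (nat \<Rightarrow> nat \<Rightarrow> nat) \<Rightarrow> nat \<Rightarrow> nat \<Rightarrow> real" where
  "path_tail n \<tau> s G L k = (\<Sum>\<gamma> | pauli_path n s G L \<gamma> \<and> path_r n s G L \<gamma> > k. \<bar>path_coef n \<tau> s G L \<gamma>\<bar>)"

text \<open>Chernoff bound with weight \<open>w = k / (L \<tau>)\<close>.\<close>
lemma path_tail_le:
  assumes gens: "\<forall>t\<in>{1..L}. signed_pauli n (gen_mat n s G t)"
    and L\<tau>: "real L * \<tau> > 0" and k: "real k \<ge> real L * \<tau>"
  shows "path_tail n \<tau> s G L k \<le> (exp 1 * (real L * \<tau>) / real k) ^ k"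
proof -
  define x where "x = real L * \<tau>"
  define w where "w = real k / x"
  let ?weight = "\<lambda>\<gamma>. \<bar>path_coef n \<tau> s G L \<gamma>\<bar> * w ^ path_r n s G L \<gamma>"
  have \<tau>: "\<tau> \<ge> 0" using L\<tau> by (simp add: zero_less_mult_iff)
  have x: "x > 0" and w: "w \<ge> 1" using k L\<tau> by (simp_all add: w_def x_def)
  have "path_tail n \<tau> s G L k * w ^ k \<le> (\<Sum>\<gamma> | pauli_path n s G L \<gamma> \<and> path_r n s G L \<gamma> > k. ?weight \<gamma>)"
    unfolding path_tail_def sum_distrib_right
    using w by (intro sum_mono mult_left_mono power_increasing) auto
  also have "\<dots> \<le> (\<Sum>\<gamma> | pauli_path n s G L \<gamma>. ?weight \<gamma>)"
    using w by (intro sum_mono2 finite_pauli_paths) auto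
  also have "\<dots> \<le> (cosh \<tau> + w * sinh \<tau>) ^ L"
    using \<tau> w by (intro path_weight_sum_le[OF gens]) auto
  also have "\<dots> \<le> exp (w * \<tau>) ^ L"
    using \<tau> w by (intro power_mono cosh_plus_sinh_le_exp add_nonneg_nonneg mult_nonneg_nonneg) auto
  also have "\<dots> = exp (w * x)" by (simp add: x_def ac_simps flip: exp_of_nat_mult)
  also have "w * x = real k * 1" using x by (simp add: w_def)
  also have "exp (real k * 1) = exp 1 ^ k" by (rule exp_of_nat_mult)
  finally have "path_tail n \<tau> s G L k \<le> exp 1 ^ k / w ^ k"
    using w by (simp add: pos_le_divide_eq)
  thus ?thesis by (simp add: w_def x_def flip: power_divide)
qed

section \<open>Truncation error\<close>

lemma Aop_minus_Atrunc:
  assumes "\<forall>t\<in>{1..L}. signed_pauli n (gen_mat n s G t)"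
  shows "Aop n \<tau> s G L - Atrunc n \<tau> s G L k
    = mat_sum (2^n) (path_term n \<tau> s G L) {\<gamma>. pauli_path n s G L \<gamma> \<and> path_r n s G L \<gamma> > k}"
proof -
  have tail: "{\<gamma>. pauli_path n s G L \<gamma> \<and> path_r n s G L \<gamma> > k}
    = {\<gamma>. pauli_path n s G L \<gamma>} - {\<gamma>. pauli_path n s G L \<gamma> \<and> path_r n s G L \<gamma> \<le> k}" by auto
  show ?thesis
    unfolding Aop_path_expansion[OF assms] Atrunc_path_expansion tail
    by (rule mat_sum_diff[OF finite_pauli_paths]) auto
qed

lemma norm_mtrace_mult_pmat_le:
  assumes M: "M \<in> carrier_mat (2^n) (2^n)" "mat_bounded c M" and q: "q \<in> paulis n"
  shows "cmod (mtrace (M * pmat n q)) \<le> c * 2^n"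
proof -
  have "mat_bounded c (M * pmat n q)"
    by (rule mat_bounded_mult_isometry[OF M unitary_pmat[OF q]])
  from norm_mtrace_le[OF mult_carrier_mat[OF M(1) pmat_carrier] this] show ?thesis by simp
qed

lemma norm_mtrace_truncation_error_le:
  assumes gens: "\<forall>t\<in>{1..L}. signed_pauli n (gen_mat n s G t)"
    and M: "M \<in> carrier_mat (2^n) (2^n)" "mat_bounded c M"
  shows "cmod (mtrace (M * (Aop n \<tau> s G L - Atrunc n \<tau> s G L k))) \<le> c * (path_tail n \<tau> s G L k * 2^n)"
proof -
  let ?T = "{\<gamma>. pauli_path n s G L \<gamma> \<and> path_r n s G L \<gamma> > k}"
    and ?D = "Aop n \<tau> s G L - Atrunc n \<tau> s G L k"
  have expansion: "mtrace (M * ?D) = (\<Sum>\<gamma>\<in>?T. mtrace (M * path_term n \<tau> s G L \<gamma>))"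
    unfolding Aop_minus_Atrunc[OF gens] mult_mat_sum[OF M(1) path_term_carrier]
    by (intro mtrace_mat_sum mult_carrier_mat[OF M(1)] path_term_carrier)
  have "cmod (mtrace (M * ?D)) \<le> (\<Sum>\<gamma>\<in>?T. \<bar>path_coef n \<tau> s G L \<gamma>\<bar> * (c * 2^n))"
    unfolding expansion
  proof (rule sum_norm_le)
    fix \<gamma> assume "\<gamma> \<in> ?T"
    hence q: "\<gamma> ! L \<in> paulis n" by (auto intro: pauli_path_nth)
    have "cmod (mtrace (M * path_term n \<tau> s G L \<gamma>))
      = \<bar>path_coef n \<tau> s G L \<gamma>\<bar> * cmod (mtrace (M * pmat n (\<gamma> ! L)))"
      unfolding path_term_def mult_smult_distrib[OF M(1) pmat_carrier]
        mtrace_smult[OF mult_carrier_mat[OF M(1) pmat_carrier]] norm_mult norm_of_real ..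
    thus "cmod (mtrace (M * path_term n \<tau> s G L \<gamma>)) \<le> \<bar>path_coef n \<tau> s G L \<gamma>\<bar> * (c * 2^n)"
      using norm_mtrace_mult_pmat_le[OF M q] by (simp add: mult_left_mono)
  qed
  also have "\<dots> = path_tail n \<tau> s G L k * (c * 2^n)"
    unfolding path_tail_def by (rule sum_distrib_right[symmetric])
  finally show ?thesis by (simp add: mult.left_commute)
qed

lemma norm_divide_diff_le:
  fixes a u d e :: "'a :: real_normed_field"
  assumes "a \<noteq> 0" and \<delta>: "\<delta> < 1" and u: "norm u \<le> c * norm a"
    and d: "norm d \<le> c * (\<delta> * norm a)" and e: "norm e \<le> \<delta> * norm a"
  shows "norm (u / a - (u - d) / (a - e)) \<le> c * (2 * \<delta> / (1 - \<delta>))"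
proof -
  have quotient: "norm (u / a) \<le> c" using u \<open>a \<noteq> 0\<close> by (simp add: norm_divide divide_le_eq)
  have "norm a - norm e \<le> norm (a - e)" by (rule norm_triangle_ineq2)
  hence denominator: "(1 - \<delta>) * norm a \<le> norm (a - e)" using e by (simp add: algebra_simps)
  have pos: "(1 - \<delta>) * norm a > 0" using \<delta> \<open>a \<noteq> 0\<close> by simp
  hence "a - e \<noteq> 0" using denominator by auto
  hence "u / a - (u - d) / (a - e) = (d - u / a * e) / (a - e)"
    using \<open>a \<noteq> 0\<close> by (simp add: field_simps)
  hence diff: "norm (u / a - (u - d) / (a - e)) = norm (d - u / a * e) / norm (a - e)"
    by (simp only: norm_divide)
  have "norm (d - u / a * e) \<le> norm d + norm (u / a) * norm e"
    using norm_triangle_ineq4[of d "u / a * e"] by (simp only: norm_mult)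
  hence numerator: "norm (d - u / a * e) \<le> c * (\<delta> * norm a) + c * (\<delta> * norm a)"
    using d mult_mono[OF quotient e order_trans[OF norm_ge_zero quotient] norm_ge_zero] by linarith
  have "norm (u / a - (u - d) / (a - e)) \<le> (c * (\<delta> * norm a) + c * (\<delta> * norm a)) / ((1 - \<delta>) * norm a)"
    unfolding diff by (rule frac_le[OF order_trans[OF norm_ge_zero numerator] numerator pos denominator])
  also have "\<dots> = c * (2 * \<delta> / (1 - \<delta>))" using \<delta> \<open>a \<noteq> 0\<close> by (simp add: field_simps)
  finally show ?thesis .
qed

lemma mtrace_mult_normalized_diff:
  assumes A: "A \<in> carrier_mat N N" and A': "A' \<in> carrier_mat N N" and M: "M \<in> carrier_mat N N"
  shows "mtrace (M * ((1 / mtrace A) \<cdot>\<^sub>m A - (1 / mtrace A') \<cdot>\<^sub>m A'))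
    = mtrace (M * A) / mtrace A - (mtrace (M * A) - mtrace (M * (A - A'))) / (mtrace A - mtrace (A - A'))"
proof -
  have MA: "M * A \<in> carrier_mat N N" and MA': "M * A' \<in> carrier_mat N N" using M A A' by auto
  have "mtrace (M * ((1 / mtrace A) \<cdot>\<^sub>m A - (1 / mtrace A') \<cdot>\<^sub>m A'))
    = 1 / mtrace A * mtrace (M * A) - 1 / mtrace A' * mtrace (M * A')"
    unfolding mult_minus_distrib_mat[OF M smult_carrier_mat[OF A] smult_carrier_mat[OF A']]
      mult_smult_distrib[OF M A] mult_smult_distrib[OF M A']
      mtrace_minus[OF smult_carrier_mat[OF MA] smult_carrier_mat[OF MA']]
      mtrace_smult[OF MA] mtrace_smult[OF MA'] ..
  thus ?thesis
    unfolding mult_minus_distrib_mat[OF M A A'] mtrace_minus[OF MA MA'] mtrace_minus[OF A A'] by simp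
qed

lemma Aop_carrier: "Aop n \<tau> s G L \<in> carrier_mat (2^n) (2^n)"
proof (induction L)
  case (Suc L)
  have "mexp (complex_of_real (- \<tau> / 2) \<cdot>\<^sub>m gen_mat n s G (Suc L)) \<in> carrier_mat (2^n) (2^n)"
    by (simp add: mexp_def gen_mat_def)
  thus ?case by (simp add: chan_def mult_carrier_mat[OF mult_carrier_mat[OF _ Suc]])
qed simp

lemma Atrunc_carrier: "Atrunc n \<tau> s G L k \<in> carrier_mat (2^n) (2^n)"
  by (simp add: Atrunc_def)

lemma norm_mtrace_mult_truncated_state_diff_le:
  assumes gens: "\<forall>t\<in>{1..L}. signed_pauli n (gen_mat n s G t)"
    and M: "M \<in> carrier_mat (2^n) (2^n)" "mat_bounded c M"
    and tail: "path_tail n \<tau> s G L k \<le> \<epsilon>" and \<epsilon>: "\<epsilon> < 1"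
  defines "A \<equiv> Aop n \<tau> s G L" and "A' \<equiv> Atrunc n \<tau> s G L k"
  shows "cmod (mtrace (M * ((1 / mtrace A) \<cdot>\<^sub>m A - (1 / mtrace A') \<cdot>\<^sub>m A'))) \<le> c * (2 * \<epsilon> / (1 - \<epsilon>))"
proof -
  obtain V where V: "V \<in> carrier_mat (2^n) (2^n)" and gram: "A = V * mat_adjoint V"
    and det: "det (V * mat_adjoint V) = 1" using Aop_eq_mult_adjoint[OF gens] unfolding A_def by blast
  have A: "A \<in> carrier_mat (2^n) (2^n)" and A': "A' \<in> carrier_mat (2^n) (2^n)"
    by (simp_all add: A_def A'_def Aop_carrier Atrunc_carrier)
  have tr: "2^n \<le> cmod (mtrace A)" using mtrace_mult_adjoint_ge_dim[OF V det] by (simp add: gram)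
  hence nonzero: "mtrace A \<noteq> 0" by (auto simp: power_le_zero_eq)
  have MA: "cmod (mtrace (M * A)) \<le> c * cmod (mtrace A)"
    unfolding gram by (rule norm_mtrace_mult_mult_adjoint_le[OF M V])
  hence c: "c \<ge> 0" using order_trans[OF norm_ge_zero MA] nonzero by (simp add: zero_le_mult_iff)
  have "path_tail n \<tau> s G L k \<ge> 0" by (simp add: path_tail_def sum_nonneg)
  hence error: "path_tail n \<tau> s G L k * 2^n \<le> \<epsilon> * cmod (mtrace A)" using tail tr by (intro mult_mono) auto
  have "cmod (mtrace (M * (A - A'))) \<le> c * (path_tail n \<tau> s G L k * 2^n)"
    unfolding A_def A'_def by (rule norm_mtrace_truncation_error_le[OF gens M])
  also have "\<dots> \<le> c * (\<epsilon> * cmod (mtrace A))" by (rule mult_left_mono[OF error c])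
  finally have MD: "cmod (mtrace (M * (A - A'))) \<le> c * (\<epsilon> * cmod (mtrace A))" .
  have "cmod (mtrace (1\<^sub>m (2^n) * (A - A'))) \<le> 1 * (path_tail n \<tau> s G L k * 2^n)"
    unfolding A_def A'_def by (rule norm_mtrace_truncation_error_le[OF gens one_carrier_mat mat_bounded_one])
  hence "cmod (mtrace (A - A')) \<le> \<epsilon> * cmod (mtrace A)"
    using error left_mult_one_mat[OF minus_carrier_mat[OF A'], of A] by simp
  from norm_divide_diff_le[OF nonzero \<epsilon> MA MD this] show ?thesis
    unfolding mtrace_mult_normalized_diff[OF A A' M(1)] .
qed

theorem mainTheorem8:
  fixes n L k :: nat and \<beta> \<Lambda> \<tau> \<epsilon> :: real
    and sg :: "nat \<Rightarrow> real" and G :: "nat \<Rightarrow> nat \<Rightarrow> nat"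
    and \<rho> \<rho>' :: "complex mat"
  assumes n: "n \<ge> 1" and \<beta>: "\<beta> > 0" and \<Lambda>: "\<Lambda> > 0" and L: "L \<ge> 1"
    and \<tau>: "\<tau> = \<beta> * \<Lambda> / (2 * real L)"
    and sg: "\<forall>t\<in>{1..L}. sg t = 1 \<or> sg t = -1"
    and G: "\<forall>t\<in>{1..L}. G t \<in> paulis n \<and> G t \<noteq> pauli_id"
    and k: "real k > exp 1 * \<beta> * \<Lambda> / 2"
    and \<rho>: "\<rho> = (1 / mtrace (Aop n \<tau> sg G L)) \<cdot>\<^sub>m Aop n \<tau> sg G L"
    and \<rho>': "\<rho>' = (1 / mtrace (Atrunc n \<tau> sg G L k)) \<cdot>\<^sub>m Atrunc n \<tau> sg G L k"
    and \<epsilon>: "\<epsilon> = exp (\<beta> * \<Lambda> / 2) * (exp 1 * \<beta> * \<Lambda> / (2 * real k)) ^ k"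
    and \<epsilon>1: "\<epsilon> < 1"
  shows "trace_norm (\<rho> - \<rho>') \<le> 2 * \<epsilon> / (1 - \<epsilon>)
    \<and> (\<forall>Ob \<in> carrier_mat (2^n) (2^n). mat_adjoint Ob = Ob \<longrightarrow>
          cmod (mtrace (Ob * (\<rho> - \<rho>'))) \<le> op_norm Ob * (2 * \<epsilon> / (1 - \<epsilon>)))"
proof -
  have gens: "\<forall>t\<in>{1..L}. signed_pauli n (gen_mat n sg G t)" using sg G by (simp add: signed_pauli_gen_mat)
  have L\<tau>: "real L * \<tau> = \<beta> * \<Lambda> / 2" using L by (simp add: \<tau>)
  have "1 * (\<beta> * \<Lambda> / 2) \<le> exp 1 * (\<beta> * \<Lambda> / 2)" using \<beta> \<Lambda> by (intro mult_right_mono) auto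
  hence "real L * \<tau> \<le> real k" using k by (simp only: L\<tau>)
  hence "path_tail n \<tau> sg G L k \<le> (exp 1 * (real L * \<tau>) / real k) ^ k"
    using \<beta> \<Lambda> by (intro path_tail_le[OF gens]) (simp_all add: L\<tau>)
  also have "\<dots> = 1 * (exp 1 * \<beta> * \<Lambda> / (2 * real k)) ^ k" by (simp add: L\<tau> mult.assoc)
  also have "\<dots> \<le> \<epsilon>" unfolding \<epsilon> using \<beta> \<Lambda> by (intro mult_right_mono) auto
  finally have tail: "path_tail n \<tau> sg G L k \<le> \<epsilon>" .
  have bound: "cmod (mtrace (M * (\<rho> - \<rho>'))) \<le> c * (2 * \<epsilon> / (1 - \<epsilon>))"
    if "M \<in> carrier_mat (2^n) (2^n)" "mat_bounded c M" for M c
    unfolding \<rho> \<rho>' by (rule norm_mtrace_mult_truncated_state_diff_le[OF gens that tail \<epsilon>1])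
  have "\<rho> - \<rho>' \<in> carrier_mat (2^n) (2^n)"
    unfolding \<rho>' by (rule minus_carrier_mat[OF smult_carrier_mat[OF Atrunc_carrier]])
  hence "trace_norm (\<rho> - \<rho>') \<le> 2 * \<epsilon> / (1 - \<epsilon>)"
    by (rule trace_norm_le) (use bound[where c = 1] in simp)
  thus ?thesis using bound mat_bounded_op_norm by blast
qed

end
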